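(* There is an absolute constant $C$ such that, if $n$ and $m$ are positive integers and $g(n,m)$ denotes the maximum size of a subset of $[n]$ with no subset sum equal to $m$, then \[g(n,m)=s(n,m):=\left\lfloor\frac{n}{\mathrm{snd}(m)}\right\rfloor+\mathrm{snd}(m)-2\] for $m\in\left[Cn\log n,\frac{n^2}{12(\log n)^2}\right]$, and \[g(n,m)=\max\left(s(n,m),(1+o(1))\sqrt{2m}\right)\] for $m\in\left[\frac{n^2}{12(\log n)^2},\binom{n+1}{2}\right]$, where $o(1)$ tends to $0$ as $n\to\infty$.
   Context: $[n]=\{1,\dots,n\}$; a subset sum of a set $S$ is a sum of the elements of some subset of $S$. $\mathrm{snd}(m)$ is the smallest positive integer that does not divide $m$. $\log$ is the natural logarithm. *)

theory Defs
  imports Complex_Main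
begin

definition snd_nd :: "nat \<Rightarrow> nat" where
  "snd_nd m = (LEAST k. 0 < k \<and> \<not> k dvd m)"

definition g_fun :: "nat \<Rightarrow> nat \<Rightarrow> nat" where
  "g_fun n m = Max {card A | A. A \<subseteq> {1..n} \<and> (\<forall>B. B \<subseteq> A \<longrightarrow> \<Sum>B \<noteq> m)}"

definition s_fun :: "nat \<Rightarrow> nat \<Rightarrow> int" where
  "s_fun n m = int (n div snd_nd m) + int (snd_nd m) - 2"

end

theory Submission
  imports Defs "HOL-Number_Theory.Number_Theory" "HOL-Real_Asymp.Real_Asymp"
    "HOL-Analysis.Complex_Transcendental"
begin

text \<open>
  Let \<open>D\<close> be the smallest non-divisor of \<open>m\<close>. The lower bound \<open>g(n,m) \<ge> s(n,m)\<close> comes from the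
  multiples of \<open>D\<close> together with \<open>r - 1\<close> elements \<open>\<equiv> 1\<close> and \<open>D - r - 1\<close> elements \<open>\<equiv> -1\<close> modulo
  \<open>D\<close>, where \<open>r = m mod D\<close>; the bound \<open>\<surd>(2m)\<close> comes from an initial segment.

  For the upper bound, a set \<open>A\<close> larger than claimed has density of order at least \<open>1 / log n\<close>.
  Pick \<open>e\<close> maximal such that almost all of \<open>A\<close> consists of multiples of \<open>e\<close>. After division by
  \<open>e\<close>, the subset sums of \<open>O(log n)\<close> elements already contain an interval of length \<open>N = n div e\<close>,
  and adding the remaining elements one at a time extends it to the whole middle range. If \<open>e\<close>
  divides \<open>m\<close>, then \<open>m\<close> is hit. Otherwise counting forces \<open>e = D\<close> and leaves at least \<open>D - 1\<close>
  elements not divisible by \<open>D\<close>; some of these sum to \<open>m\<close> modulo \<open>D\<close>.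

  The interval is found as follows. Choosing one element from each of several disjoint pairs with
  differences \<open>\<delta>\<^sub>1, \<delta>\<^sub>2, \<dots>\<close> realises all subset sums of the \<open>\<delta>\<^sub>i\<close> up to translation. Some
  \<open>d = O(log n)\<close> is the difference of many pairs. Inside a residue class modulo \<open>d\<close>, pairs may be
  missing at some scales, but the density limits the total number of pairs that is needed to climb
  from \<open>d\<close> to \<open>N\<close>. The resulting long progression with difference \<open>d\<close> is filled up to an interval by
  adding and removing a few elements from the residue classes modulo \<open>d\<close> occupied by \<open>A\<close>; how many
  are needed is bounded by the diameter of a Cayley graph.
\<close>

section \<open>Subset sums\<close>

definition subset_sums :: "nat set \<Rightarrow> nat set" where
  "subset_sums U = (\<lambda>W. \<Sum>W) ` Pow U"

lemma subset_sums_mono: "U \<subseteq> V \<Longrightarrow> subset_sums U \<subseteq> subset_sums V"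
  by (auto simp: subset_sums_def)

lemma subset_sums_Un:
  assumes "finite U" "finite V" "U \<inter> V = {}" "x \<in> subset_sums U" "y \<in> subset_sums V"
  shows "x + y \<in> subset_sums (U \<union> V)"
proof -
  obtain W Z where W: "W \<subseteq> U" "x = \<Sum>W" and Z: "Z \<subseteq> V" "y = \<Sum>Z"
    using assms(4,5) by (auto simp: subset_sums_def)
  have "x + y = \<Sum>(W \<union> Z)"
    unfolding W(2) Z(2)
    by (rule sum.union_disjoint[symmetric]) (use assms W Z finite_subset in blast)+
  then show ?thesis
    using W Z by (auto simp: subset_sums_def)
qed

lemma subset_sums_le_card_mult:
  assumes "y \<in> subset_sums U" "U \<subseteq> {1..N}"
  shows "y \<le> card U * N"
proof -
  obtain W where W: "W \<subseteq> U" "y = \<Sum>W"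
    using assms(1) by (auto simp: subset_sums_def)
  have "finite U"
    using assms(2) finite_subset by blast
  have "y \<le> card W * N"
  proof -
    have "i \<le> N" if "i \<in> W" for i using that W(1) assms(2) by auto
    then show ?thesis unfolding W(2) using sum_bounded_above[of W "\<lambda>x. x" N] by simp
  qed
  also have "\<dots> \<le> card U * N"
    using card_mono[OF \<open>finite U\<close> W(1)] by simp
  finally show ?thesis .
qed

text \<open>An interval of length at least \<open>N\<close> and its translate by
  \<open>a <= N\<close> leave no gap, so each new element \<open>a\<close> lengthens the interval by
  \<open>a\<close>.\<close>

lemma subset_sums_extend_interval:
  assumes "finite F" "finite U" "F \<inter> U = {}" "\<forall>a\<in>F. a \<le> N" "{x..x+N} \<subseteq> subset_sums U"
  shows "{x..x+N+\<Sum>F} \<subseteq> subset_sums (U \<union> F)"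
  using assms(1,3,4)
proof (induction F rule: finite_induct)
  case empty
  then show ?case using assms(5) by simp
next
  case (insert a F)
  have IH: "{x..x+N+\<Sum>F} \<subseteq> subset_sums (U \<union> F)"
    using insert by auto
  show ?case
  proof
    fix y assume y: "y \<in> {x..x+N+\<Sum>(insert a F)}"
    show "y \<in> subset_sums (U \<union> insert a F)"
    proof (cases "y \<le> x + N + \<Sum>F")
      case True
      then have "y \<in> subset_sums (U \<union> F)" using IH y by auto
      then show ?thesis using subset_sums_mono[of "U \<union> F" "U \<union> insert a F"] by auto
    next
      case False
      have "a \<le> N" using insert.prems by simp
      moreover have "\<Sum>(insert a F) = a + \<Sum>F" using insert.hyps by simp
      ultimately have "y - a \<in> {x..x+N+\<Sum>F}"
        using y False unfolding atLeastAtMost_iff by linarith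
      then have "y - a \<in> subset_sums (U \<union> F)"
        using IH by blast
      moreover have "a \<in> subset_sums {a}"
        by (auto simp: subset_sums_def image_iff intro!: bexI[of _ "{a}"])
      ultimately have "(y - a) + a \<in> subset_sums ((U \<union> F) \<union> {a})"
        by (intro subset_sums_Un) (use insert assms in auto)
      moreover have "(y - a) + a = y" using False \<open>a \<le> N\<close> by simp
      ultimately show ?thesis by (simp add: insert_commute)
    qed
  qed
qed

section \<open>Short signed representations of residues\<close>

text \<open>The ball of radius \<open>k\<close> about \<open>0\<close> in the Cayley graph of the
  integers modulo \<open>d\<close> with generators \<open>S\<close> and their negatives. The
  coefficients \<open>f\<close> later tell how many elements of each class to add or remove.\<close>

definition signed_residues :: "nat \<Rightarrow> nat set \<Rightarrow> nat \<Rightarrow> int set" where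
  "signed_residues d S k =
     {(\<Sum>s\<in>S. f s * int s) mod int d | f. (\<Sum>s\<in>S. \<bar>f s\<bar>) \<le> int k}"

lemma signed_residues_mono: "j \<le> k \<Longrightarrow> signed_residues d S j \<subseteq> signed_residues d S k"
  unfolding signed_residues_def by fastforce

lemma signed_residues_step:
  assumes "finite S" "s \<in> S" "x \<in> signed_residues d S k" "\<bar>e\<bar> = 1"
  shows "(x + e * int s) mod int d \<in> signed_residues d S (Suc k)"
proof -
  obtain f where f: "x = (\<Sum>s\<in>S. f s * int s) mod int d" "(\<Sum>s\<in>S. \<bar>f s\<bar>) \<le> int k"
    using assms(3) by (auto simp: signed_residues_def)
  define g where "g = f(s := f s + e)"
  have rest: "(\<Sum>t\<in>S-{s}. g t * int t) = (\<Sum>t\<in>S-{s}. f t * int t)"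
       "(\<Sum>t\<in>S-{s}. \<bar>g t\<bar>) = (\<Sum>t\<in>S-{s}. \<bar>f t\<bar>)"
    by (auto simp: g_def intro!: sum.cong)
  have 1: "(\<Sum>t\<in>S. g t * int t) = (\<Sum>t\<in>S. f t * int t) + e * int s"
    using rest by (simp add: sum.remove[OF assms(1,2)] g_def algebra_simps)
  have 2: "(\<Sum>t\<in>S. \<bar>g t\<bar>) \<le> (\<Sum>t\<in>S. \<bar>f t\<bar>) + 1"
    using rest assms(4) by (simp add: sum.remove[OF assms(1,2)] g_def)
  have "(x + e * int s) mod int d = (\<Sum>t\<in>S. g t * int t) mod int d"
    unfolding 1 f(1) by (simp add: mod_simps)
  then show ?thesis
    unfolding signed_residues_def using 2 f(2) by (intro CollectI exI[of _ g]) auto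
qed

text \<open>The translations preserving \<open>R\<close> form a subgroup \<open>H\<close> of the
  integers containing \<open>d\<close> and \<open>S\<close>. Its positive generator divides
  \<open>d\<close> and all of \<open>S\<close>, so it is \<open>1\<close>, because no prime factor
  of \<open>d\<close> divides all of \<open>S\<close>.\<close>

lemma closed_residues_full:
  fixes d :: nat and R :: "int set"
  assumes "d > 0" "0 \<in> R"
    and plus: "\<And>x s. x \<in> R \<Longrightarrow> s \<in> S \<Longrightarrow> (x + int s) mod int d \<in> R"
    and minus: "\<And>x s. x \<in> R \<Longrightarrow> s \<in> S \<Longrightarrow> (x - int s) mod int d \<in> R"
    and R: "R \<subseteq> {0..<int d}"
    and gen: "\<And>q. prime q \<Longrightarrow> q dvd d \<Longrightarrow> \<exists>s\<in>S. \<not> q dvd s"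
  shows "R = {0..<int d}"
proof -
  define H where "H = {x. \<forall>y\<in>R. (y + x) mod int d \<in> R \<and> (y - x) mod int d \<in> R}"
  have add: "x + y \<in> H" if "x \<in> H" "y \<in> H" for x y
  proof -
    have "(z + (x + y)) mod int d \<in> R \<and> (z - (x + y)) mod int d \<in> R" if "z \<in> R" for z
    proof -
      have "((z + x) mod int d + y) mod int d \<in> R" "((z - x) mod int d - y) mod int d \<in> R"
        using that \<open>x \<in> H\<close> \<open>y \<in> H\<close> by (auto simp: H_def)
      then show ?thesis by (simp add: mod_simps algebra_simps)
    qed
    then show ?thesis by (auto simp: H_def)
  qed
  have neg: "- x \<in> H" if "x \<in> H" for x using that by (auto simp: H_def)
  have zero: "0 \<in> H" using R by (auto simp: H_def)
  have multn: "int k * x \<in> H" if "x \<in> H" for k x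
    by (induction k) (use zero add that in \<open>auto simp: algebra_simps\<close>)
  have mult: "k * x \<in> H" if "x \<in> H" for k x
  proof (cases "k \<ge> 0")
    case True then show ?thesis using multn[OF that, of "nat k"] by simp
  next
    case False then show ?thesis using neg[OF multn[OF that, of "nat (-k)"]] by simp
  qed
  have dH: "int d \<in> H" using R by (auto simp: H_def)
  have SH: "int s \<in> H" if "s \<in> S" for s using plus minus that by (auto simp: H_def)
  define g where "g = (LEAST g. g > 0 \<and> int g \<in> H)"
  have g: "g > 0" "int g \<in> H"
    using LeastI[of "\<lambda>g. g > 0 \<and> int g \<in> H" d] dH assms(1) by (auto simp: g_def)
  have gdvd: "int g dvd x" if "x \<in> H" for x
  proof (rule ccontr)
    assume "\<not> int g dvd x"
    have "x + (- (x div int g)) * int g \<in> H" using add[OF that mult[OF g(2)]] by blast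
    moreover have "x + (- (x div int g)) * int g = x mod int g"
      by (simp add: minus_div_mult_eq_mod[symmetric])
    ultimately have "x mod int g \<in> H" by simp
    moreover have "x mod int g > 0"
      using \<open>\<not> int g dvd x\<close> g(1) by (metis dvd_eq_mod_eq_0 order_le_less pos_mod_sign of_nat_0_less_iff)
    moreover have "nat (x mod int g) < g" using g(1) by (simp add: nat_less_iff)
    ultimately show False
      using not_less_Least[of "nat (x mod int g)" "\<lambda>g. g > 0 \<and> int g \<in> H"] by (auto simp: g_def)
  qed
  have "g = 1"
  proof (rule ccontr)
    assume "g \<noteq> 1"
    then obtain q where q: "prime q" "q dvd g" using prime_factor_nat by blast
    have "q dvd d" using gdvd[OF dH] q(2) by auto
    then obtain s where "s \<in> S" "\<not> q dvd s" using gen q(1) by blast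
    moreover have "g dvd s" using gdvd[OF SH[OF \<open>s \<in> S\<close>]] by auto
    ultimately show False using q(2) dvd_trans by blast
  qed
  then have "1 \<in> H" using g by simp
  have "x \<in> R" if "x \<in> {0..<int d}" for x
  proof -
    have "x * 1 \<in> H" using mult[OF \<open>1 \<in> H\<close>] by blast
    then have "(0 + x) mod int d \<in> R" using assms(2) unfolding H_def by fastforce
    then show ?thesis using that by simp
  qed
  then show ?thesis using R by blast
qed

text \<open>If \<open>x\<close> is at distance \<open>j + 2\<close> from \<open>0\<close> in the Cayley graph, then \<open>x + S\<close> avoids the
  ball of radius \<open>j\<close>; hence every three steps gain \<open>card S\<close> residues.\<close>
lemma signed_residues_full:
  assumes "d > 0" "S \<subseteq> {..<d}" "S \<noteq> {}"
    and gen: "\<And>q. prime q \<Longrightarrow> q dvd d \<Longrightarrow> \<exists>s\<in>S. \<not> q dvd s"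
  shows "signed_residues d S (3 * (d div card S + 1)) = {0..<int d}"
proof -
  let ?R = "signed_residues d S" and ?h = "card S"
  have fin: "finite S" using assms(2) finite_subset by blast
  have sub: "?R k \<subseteq> {0..<int d}" for k using assms(1) by (auto simp: signed_residues_def)
  have finR: "finite (?R k)" for k by (rule finite_subset[OF sub]) simp
  have zero: "0 \<in> ?R k" for k
    unfolding signed_residues_def by (intro CollectI exI[of _ "\<lambda>_. 0"]) auto
  have st: "(x + int s) mod int d \<in> ?R (Suc k)" "(x - int s) mod int d \<in> ?R (Suc k)"
    if "x \<in> ?R k" "s \<in> S" for x s k
    using signed_residues_step[OF fin that(2,1), of 1] signed_residues_step[OF fin that(2,1), of "-1"]
    by auto
  have full: "?R k = {0..<int d}" if "?R (Suc k) = ?R k" for k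
    by (rule closed_residues_full[OF assms(1) zero _ _ sub gen]) (use st that in auto)
  have grow: "?R (3 * i) = {0..<int d} \<or> card (?R (3 * i)) \<ge> i * ?h" for i
  proof (induction i)
    case 0 show ?case by simp
  next
    case (Suc i)
    let ?j = "3 * i"
    have e3: "3 * Suc i = Suc (Suc (Suc ?j))" by simp
    show ?case
    proof (cases "?R (Suc (Suc ?j)) = ?R (Suc ?j)")
      case True
      then have "?R (Suc ?j) = {0..<int d}" using full by blast
      moreover have "?R (Suc ?j) \<subseteq> ?R (3 * Suc i)" by (rule signed_residues_mono) simp
      ultimately show ?thesis using sub by blast
    next
      case False
      have "?R ?j \<noteq> {0..<int d}"
      proof
        assume "?R ?j = {0..<int d}"
        then have "?R (Suc ?j) = {0..<int d}" "?R (Suc (Suc ?j)) = {0..<int d}"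
          using sub signed_residues_mono[of ?j "Suc ?j" d S] signed_residues_mono[of ?j "Suc (Suc ?j)" d S]
          by auto
        then show False using False by simp
      qed
      then have IH: "card (?R ?j) \<ge> i * ?h" using Suc by blast
      obtain x where x: "x \<in> ?R (Suc (Suc ?j))" "x \<notin> ?R (Suc ?j)"
        using False signed_residues_mono[of "Suc ?j" "Suc (Suc ?j)" d S] by auto
      define X where "X = (\<lambda>s. (x + int s) mod int d) ` S"
      have XR: "X \<subseteq> ?R (3 * Suc i)"
        using st(1)[OF x(1)] unfolding X_def e3 by blast
      have "X \<inter> ?R ?j = {}"
      proof (rule ccontr)
        assume "X \<inter> ?R ?j \<noteq> {}"
        then obtain s where s: "s \<in> S" "(x + int s) mod int d \<in> ?R ?j" by (auto simp: X_def)
        then have "((x + int s) mod int d - int s) mod int d \<in> ?R (Suc ?j)" using st(2) by blast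
        moreover have "((x + int s) mod int d - int s) mod int d = x"
          using x(1) sub[of "Suc (Suc ?j)"] by (auto simp: mod_simps)
        ultimately show False using x(2) by simp
      qed
      moreover have "card X = ?h"
        unfolding X_def
      proof (rule card_image, rule inj_onI)
        fix s t assume st: "s \<in> S" "t \<in> S" "(x + int s) mod int d = (x + int t) mod int d"
        then have "int s mod int d = int t mod int d"
          by (metis add_diff_cancel_left' mod_diff_left_eq)
        then show "s = t" using st assms(2) by (auto simp: subset_iff)
      qed
      moreover have "?R ?j \<union> X \<subseteq> ?R (3 * Suc i)"
        using XR signed_residues_mono[of ?j "3 * Suc i" d S] by auto
      moreover have "finite X" using fin by (simp add: X_def)
      ultimately have "card (?R ?j) + ?h \<le> card (?R (3 * Suc i))"
        by (metis card_Un_disjoint card_mono finR inf_commute)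
      then show ?thesis using IH by auto
    qed
  qed
  have "?h > 0" using fin assms(3) by (simp add: card_gt_0_iff)
  then have "d < (d div ?h + 1) * ?h"
    by (metis div_less_iff_less_mult less_add_one)
  moreover have "card (?R k) \<le> d" for k using card_mono[OF _ sub] by simp
  ultimately show ?thesis using grow[of "d div ?h + 1"] by (meson leD le_trans)
qed

section \<open>Long progressions of subset sums\<close>

text \<open>The set \<open>V\<close> collects elements of \<open>X\<close> that are already in use. Measuring widths robustly, i.e.
  in the worst case over all small \<open>V\<close>, makes the pairs chosen later automatically disjoint.\<close>
definition narrow_in :: "nat set \<Rightarrow> nat \<Rightarrow> nat \<Rightarrow> nat set \<Rightarrow> bool" where
  "narrow_in X s w V \<longleftrightarrow> (\<exists>Y\<subseteq>X - V. card Y = s \<and> (\<forall>y\<in>Y. \<forall>z\<in>Y. z \<le> y + w))"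

definition robust_width :: "nat set \<Rightarrow> nat \<Rightarrow> nat \<Rightarrow> nat" where
  "robust_width X R s = (LEAST w. \<forall>V. finite V \<and> card V \<le> R \<longrightarrow> narrow_in X s w V)"

text \<open>Any \<open>s\<close> elements that survive the deletion lie in \<open>{1..N}\<close>, so
  \<open>w = N\<close> qualifies and the \<open>LEAST\<close> in \<open>robust_width\<close> is
  attained.\<close>

lemma robust_width_bounds:
  assumes "X \<subseteq> {1..N}" "R + s \<le> card X"
  shows "robust_width X R s \<le> N"
    and "finite V \<Longrightarrow> card V \<le> R \<Longrightarrow> narrow_in X s (robust_width X R s) V"
proof -
  have fin: "finite X" using assms(1) finite_subset by blast
  have N: "\<forall>V. finite V \<and> card V \<le> R \<longrightarrow> narrow_in X s N V"
  proof (intro allI impI)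
    fix V :: "nat set" assume V: "finite V \<and> card V \<le> R"
    have "s \<le> card (X - V)"
      using diff_card_le_card_Diff[of V X] V assms(2) by linarith
    then obtain Y where "Y \<subseteq> X - V" "card Y = s"
      using obtain_subset_with_card_n by metis
    moreover have "z \<le> y + N" if "y \<in> Y" "z \<in> Y" for y z
    proof -
      have "z \<in> {1..N}" using \<open>Y \<subseteq> X - V\<close> that assms(1) by blast
      then show ?thesis by simp
    qed
    ultimately show "narrow_in X s N V" unfolding narrow_in_def by blast
  qed
  show "robust_width X R s \<le> N"
    unfolding robust_width_def using N by (rule Least_le)
  show "finite V \<Longrightarrow> card V \<le> R \<Longrightarrow> narrow_in X s (robust_width X R s) V"
    using LeastI[of "\<lambda>w. \<forall>V. finite V \<and> card V \<le> R \<longrightarrow> narrow_in X s w V", OF N]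
    unfolding robust_width_def by blast
qed

lemma robust_width_le:
  assumes "\<And>V. finite V \<Longrightarrow> card V \<le> R \<Longrightarrow> narrow_in X s w V"
  shows "robust_width X R s \<le> w"
  unfolding robust_width_def by (rule Least_le) (use assms in blast)

text \<open>Cut a cluster of \<open>2 * s\<close> elements at the middle of its range: by pigeonhole
  one half holds \<open>s\<close> elements within half the width. Every \<open>V\<close> admissible
  for \<open>R\<close> is admissible for \<open>R'\<close>.\<close>

lemma robust_width_double:
  assumes "X \<subseteq> {1..N}" "R \<le> R'" "R' + 2 * s \<le> card X" "s > 0"
  shows "2 * robust_width X R s \<le> robust_width X R' (2 * s)"
proof -
  define w where "w = robust_width X R' (2 * s)"
  have "robust_width X R s \<le> w div 2"
  proof (rule robust_width_le)
    fix V :: "nat set" assume V: "finite V" "card V \<le> R"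
    then have "narrow_in X (2 * s) w V"
      unfolding w_def using robust_width_bounds(2)[OF assms(1,3)] assms(2) by auto
    then obtain Y where Y: "Y \<subseteq> X - V" "card Y = 2 * s" "\<forall>y\<in>Y. \<forall>z\<in>Y. z \<le> y + w"
      unfolding narrow_in_def by blast
    have fin: "finite Y" using Y(2) assms(4) card.infinite by fastforce
    have "Y \<noteq> {}" using Y(2) assms(4) by auto
    define a where "a = Min Y"
    have a: "a \<in> Y" "\<And>y. y \<in> Y \<Longrightarrow> a \<le> y" using fin \<open>Y \<noteq> {}\<close> by (auto simp: a_def)
    define L where "L = {y\<in>Y. y \<le> a + w div 2}"
    define H where "H = {y\<in>Y. y > a + w div 2}"
    have "card L + card H = 2 * s"
    proof -
      have "L \<union> H = Y" "L \<inter> H = {}" "finite L" "finite H" using fin by (auto simp: L_def H_def)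
      then show ?thesis using Y(2) card_Un_disjoint[of L H] by simp
    qed
    then have "s \<le> card L \<or> s \<le> card H" by linarith
    moreover have "z \<le> y + w div 2" if "y \<in> L" "z \<in> L" for y z
    proof -
      have "z \<le> a + w div 2" "a \<le> y" using that a(2) by (auto simp: L_def)
      then show ?thesis by simp
    qed
    moreover have "z \<le> y + w div 2" if "y \<in> H" "z \<in> H" for y z
    proof -
      have "z \<le> a + w" "a + w div 2 < y" using that a(1) Y(3) by (auto simp: H_def)
      then show ?thesis by linarith
    qed
    moreover have "L \<subseteq> X - V" "H \<subseteq> X - V" using Y(1) by (auto simp: L_def H_def)
    ultimately obtain Z where Z: "Z \<subseteq> X - V" "s \<le> card Z" "\<forall>y\<in>Z. \<forall>z\<in>Z. z \<le> y + w div 2"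
      by blast
    obtain Z' where "Z' \<subseteq> Z" "card Z' = s" using Z(2) obtain_subset_with_card_n by metis
    then show "narrow_in X s (w div 2) V"
      unfolding narrow_in_def using Z(1,3) by (intro exI[of _ Z'] conjI) auto
  qed
  then show ?thesis unfolding w_def by linarith
qed

text \<open>Minimality of the width at scale \<open>s\<close> provides a set \<open>V1\<close> after
  whose removal no \<open>s\<close> elements lie strictly closer together than that width. Deleting
  both \<open>V\<close> and \<open>V1\<close> still leaves a cluster of \<open>2 * s\<close>
  elements, and any \<open>s\<close> of these contain two points far enough apart.\<close>

lemma robust_width_pair:
  assumes "X \<subseteq> {1..N}" "R + 2 * s \<le> card X" "s > 0" "Ra + Rb \<le> R"
    and pos: "robust_width X Ra s > 0" and V: "finite V" "card V \<le> Rb"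
  shows "\<exists>a e. a \<in> X - V \<and> a + e \<in> X - V \<and> robust_width X Ra s \<le> e \<and> e \<le> robust_width X R (2 * s)"
proof -
  let ?w = "robust_width X Ra s"
  have "\<not> (\<forall>V. finite V \<and> card V \<le> Ra \<longrightarrow> narrow_in X s (?w - 1) V)"
    by (rule not_less_Least[of "?w - 1" "\<lambda>w. \<forall>V. finite V \<and> card V \<le> Ra \<longrightarrow> narrow_in X s w V",
          folded robust_width_def]) (use pos in simp)
  then obtain V1 where V1: "finite V1" "card V1 \<le> Ra" "\<not> narrow_in X s (?w - 1) V1" by blast
  have "card (V \<union> V1) \<le> R"
    using card_Un_le[of V V1] V V1 assms(4) by linarith
  then have "narrow_in X (2 * s) (robust_width X R (2 * s)) (V \<union> V1)"
    using V V1 by (intro robust_width_bounds(2)[OF assms(1,2)]) auto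
  then obtain Y where Y: "Y \<subseteq> X - (V \<union> V1)" "card Y = 2 * s"
      "\<forall>y\<in>Y. \<forall>z\<in>Y. z \<le> y + robust_width X R (2 * s)"
    unfolding narrow_in_def by blast
  obtain Z where Z: "Z \<subseteq> Y" "card Z = s"
    using Y(2) obtain_subset_with_card_n[of s Y] by auto
  have "Z \<subseteq> X - V1" using Z Y by blast
  then obtain y z where yz: "y \<in> Z" "z \<in> Z" "\<not> z \<le> y + (?w - 1)"
    using V1(3)[unfolded narrow_in_def] Z(2) by blast
  have 1: "y \<in> X - V" "z \<in> X - V" "z \<le> y + robust_width X R (2 * s)"
    using yz(1,2) Z(1) Y(1,3) by blast+
  have 2: "y + (z - y) = z" "?w \<le> z - y" "z - y \<le> robust_width X R (2 * s)"
    using yz(3) pos 1(3) by linarith+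
  show ?thesis
    by (rule exI[of _ y], rule exI[of _ "z - y"]) (simp only: 1 2 simp_thms)
qed

text \<open>Here \<open>l\<close> measures distance, not the number of terms, so it compares
  directly with widths and with \<open>N\<close> and need not be a multiple of \<open>d\<close>. The
  starting point is free because each added pair translates it.\<close>

definition ap_reach :: "nat \<Rightarrow> nat set \<Rightarrow> nat \<Rightarrow> bool" where
  "ap_reach d U l \<longleftrightarrow> (\<exists>x. \<forall>j. j * d \<le> l \<longrightarrow> x + j * d \<in> subset_sums U)"

lemma ap_reach_mono: "ap_reach d U l \<Longrightarrow> l' \<le> l \<Longrightarrow> ap_reach d U l'"
  unfolding ap_reach_def by (meson order_trans)

text \<open>Using exactly one of \<open>a\<close> and \<open>a + e\<close> yields two translates of
  the progression at distance \<open>e\<close>; since \<open>e <= l + d\<close>, no term is missing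
  between them.\<close>

lemma ap_reach_step:
  assumes "ap_reach d U l" "finite U" "a \<notin> U" "a + e \<notin> U" "e > 0" "d dvd e" "e \<le> l + d"
  shows "ap_reach d (U \<union> {a, a + e}) (l + e)"
proof -
  obtain x where x: "\<And>j. j * d \<le> l \<Longrightarrow> x + j * d \<in> subset_sums U"
    using assms(1) unfolding ap_reach_def by blast
  obtain t where t: "e = t * d" using assms(6) by (auto simp: dvd_def mult.commute)
  have d: "d > 0" using t assms(5) by (cases d) auto
  have "(x + a) + j * d \<in> subset_sums (U \<union> {a, a + e})" if j: "j * d \<le> l + e" for j
  proof (cases "j * d \<le> l")
    case True
    have "a \<in> subset_sums {a, a + e}"
      by (auto simp: subset_sums_def image_iff intro!: bexI[of _ "{a}"])
    then have "(x + j * d) + a \<in> subset_sums (U \<union> {a, a + e})"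
      by (intro subset_sums_Un) (use x[OF True] assms in auto)
    then show ?thesis by (simp add: algebra_simps)
  next
    case False
    have "t * d < j * d + d" using False assms(7) t by linarith
    then have "t * d < (j + 1) * d" by simp
    then have tj: "t \<le> j" using d by (metis Suc_eq_plus1 less_Suc_eq_le mult_less_cancel2)
    have "(j - t) * d \<le> l" using j t by (simp add: diff_mult_distrib)
    then have "(x + (j - t) * d) + (a + e) \<in> subset_sums (U \<union> {a, a + e})"
      by (intro subset_sums_Un) (use x assms in \<open>auto simp: subset_sums_def image_iff intro!: bexI[of _ "{a + e}"]\<close>)
    moreover have "(x + (j - t) * d) + (a + e) = (x + a) + j * d"
    proof -
      have "(j - t) * d + t * d = j * d" using tj by (metis add_mult_distrib le_add_diff_inverse2)
      then show ?thesis using t by simp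
    qed
    ultimately show ?thesis by simp
  qed
  then show ?thesis unfolding ap_reach_def by blast
qed

text \<open>The set built so far serves as the forbidden set \<open>V\<close>, so each new pair is
  disjoint from the earlier ones, and \<open>R\<close> limits how many elements can be used.\<close>

lemma ap_reach_steps:
  assumes pairs: "\<And>V. finite V \<Longrightarrow> card V \<le> R \<Longrightarrow>
      \<exists>a e. a \<in> A - V \<and> a + e \<in> A - V \<and> d dvd e \<and> lo \<le> e \<and> e \<le> hi"
    and "lo > 0" "hi \<le> l + d" "ap_reach d U l" "finite U" "U \<subseteq> A" "card U + 2 * c \<le> R"
  shows "\<exists>U'. finite U' \<and> U' \<subseteq> A \<and> card U' \<le> card U + 2 * c \<and> ap_reach d U' (l + c * lo)"
  using assms(7)
proof (induction c)
  case 0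
  then show ?case using assms by auto
next
  case (Suc c)
  then obtain U1 where U1: "finite U1" "U1 \<subseteq> A" "card U1 \<le> card U + 2 * c" "ap_reach d U1 (l + c * lo)"
    by auto
  have "card U1 \<le> R" using U1(3) Suc.prems by simp
  then obtain a e where ae: "a \<in> A - U1" "a + e \<in> A - U1" "d dvd e" "lo \<le> e" "e \<le> hi"
    using pairs[OF U1(1)] by blast
  have "ap_reach d (U1 \<union> {a, a + e}) (l + c * lo + e)"
    by (rule ap_reach_step) (use U1 ae assms(2,3) in auto)
  then have "ap_reach d (U1 \<union> {a, a + e}) (l + Suc c * lo)"
    by (rule ap_reach_mono) (use ae in auto)
  moreover have "card (U1 \<union> {a, a + e}) \<le> card U + 2 * Suc c"
    using card_Un_le[of U1 "{a, a+e}"] card_insert_le_m1[of 2 "{a+e}" a] U1(3) by auto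
  ultimately show ?case
    using U1 ae by (intro exI[of _ "U1 \<union> {a, a + e}"]) auto
qed

text \<open>There are pairs with difference between \<open>w i\<close> and \<open>w (i + 1)\<close>, so a progression of length
  \<open>w (i + 1)\<close> grows to length \<open>w (i + 2)\<close> at the cost of about \<open>w (i + 2) / w i\<close> pairs. As
  \<open>w i / 2 ^ i\<close> is nondecreasing, these costs add up to little more than the number of scales.\<close>
lemma ap_reach_chain:
  fixes N R d :: nat and X A :: "nat set"
  defines "w \<equiv> (\<lambda>i. robust_width X (i * R) (2 ^ i))"
  assumes X: "X \<subseteq> A" "A \<subseteq> {1..N}" and d: "d > 0"
    and cong: "\<And>x e. x \<in> X \<Longrightarrow> x + e \<in> X \<Longrightarrow> d dvd e"
    and base: "\<And>V. finite V \<Longrightarrow> card V \<le> R \<Longrightarrow> \<exists>a. a \<in> A - V \<and> a + d \<in> A - V"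
    and card: "I * R + 2 ^ I \<le> card X" and pos: "w 1 > 0"
    and t: "t + 2 \<le> I"
    and cost: "2 * (w 2 div d + 1 + (\<Sum>i=1..t. w (i + 2) div w i + 1)) \<le> R"
  shows "\<exists>U. finite U \<and> U \<subseteq> A \<and> ap_reach d U (w (t + 2)) \<and>
      card U \<le> 2 * (w 2 div d + 1 + (\<Sum>i=1..t. w (i + 2) div w i + 1))"
  using t cost
proof (induction t)
  case 0
  \<comment> \<open>Starting from the empty set, pairs with difference exactly \<open>d\<close>
    raise the reach from \<open>0\<close> to at least \<open>w 2\<close>.\<close>
  have "\<exists>U'. finite U' \<and> U' \<subseteq> A \<and> card U' \<le> card ({}::nat set) + 2 * (w 2 div d + 1) \<and>
      ap_reach d U' (0 + (w 2 div d + 1) * d)"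
  proof (rule ap_reach_steps[where R = R and hi = d])
    show "\<exists>a e. a \<in> A - V \<and> a + e \<in> A - V \<and> d dvd e \<and> d \<le> e \<and> e \<le> d"
      if "finite V" "card V \<le> R" for V using base[OF that] by (meson dvd_refl order_refl)
    show "ap_reach d {} 0" unfolding ap_reach_def using d by (auto simp: subset_sums_def)
  qed (use d 0 in auto)
  then have ex: "\<exists>U'. finite U' \<and> U' \<subseteq> A \<and> card U' \<le> 2 * (w 2 div d + 1) \<and>
      ap_reach d U' (0 + (w 2 div d + 1) * d)"
    by simp
  have le: "w 2 \<le> 0 + (w 2 div d + 1) * d"
    using dividend_less_div_times[OF d, of "w 2"] by simp
  show ?case
  proof -
    obtain U' where "finite U'" "U' \<subseteq> A" "card U' \<le> 2 * (w 2 div d + 1)"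
        "ap_reach d U' (0 + (w 2 div d + 1) * d)"
      using ex by blast
    then show ?thesis
      using ap_reach_mono[OF _ le] by (intro exI[of _ U']) (simp add: numeral_2_eq_2)
  qed
next
  case (Suc t)
  \<comment> \<open>Each pair used here has difference at least \<open>w (t + 1)\<close>, so
    \<open>?c\<close> of them raise the reach to \<open>w (t + 3)\<close>; no difference exceeds
    \<open>w (t + 2)\<close>, the reach already available.\<close>
  let ?c = "w (t + 3) div w (t + 1) + 1"
  have mono: "0 < w (Suc i)" if "Suc i \<le> I" for i using that
  proof (induction i)
    case 0 then show ?case using pos by simp
  next
    case (Suc i)
    have "Suc (Suc i) * R + 2 * 2 ^ Suc i \<le> card X"
    proof -
      have "Suc (Suc i) * R \<le> I * R" using Suc.prems by (intro mult_right_mono) auto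
      moreover have "(2::nat) ^ Suc (Suc i) \<le> 2 ^ I" using Suc.prems by (intro power_increasing) auto
      ultimately show ?thesis using card by simp
    qed
    then have "2 * w (Suc i) \<le> w (Suc (Suc i))"
      unfolding w_def using robust_width_double[of X N "Suc i * R" "Suc (Suc i) * R" "2 ^ Suc i"] X by auto
    then show ?case using Suc by auto
  qed
  have cost': "(\<Sum>i=1..Suc t. w (i + 2) div w i + 1) = (\<Sum>i=1..t. w (i + 2) div w i + 1) + ?c"
    by (simp add: numeral_2_eq_2 numeral_3_eq_3)
  obtain U where U: "finite U" "U \<subseteq> A" "ap_reach d U (w (t + 2))"
      "card U \<le> 2 * (w 2 div d + 1 + (\<Sum>i=1..t. w (i + 2) div w i + 1))"
    using Suc cost' by auto
  have "\<exists>U'. finite U' \<and> U' \<subseteq> A \<and> card U' \<le> card U + 2 * ?c \<and> ap_reach d U' (w (t + 2) + ?c * w (t + 1))"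
  proof (rule ap_reach_steps[where R = R and hi = "w (t + 2)"])
    fix V :: "nat set" assume V: "finite V" "card V \<le> R"
    \<comment> \<open>The budget in \<open>w\<close> grows with the scale so that
      \<open>(t + 1) * R\<close> for the minimality argument and \<open>R\<close> for
      \<open>V\<close> fit together into \<open>(t + 2) * R\<close>.\<close>
    have "\<exists>a e. a \<in> X - V \<and> a + e \<in> X - V \<and> robust_width X ((t + 1) * R) (2 ^ (t + 1)) \<le> e \<and>
        e \<le> robust_width X ((t + 2) * R) (2 * 2 ^ (t + 1))"
    proof (rule robust_width_pair[where Rb = R])
      have "(t + 2) * R \<le> I * R" using Suc.prems by (intro mult_right_mono) auto
      moreover have "(2::nat) ^ (t + 2) \<le> 2 ^ I" using Suc.prems by (intro power_increasing) auto
      ultimately show "(t + 2) * R + 2 * 2 ^ (t + 1) \<le> card X" using card by simp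
      show "X \<subseteq> {1..N}" using X by blast
      show "0 < robust_width X ((t + 1) * R) (2 ^ (t + 1))"
        using mono[of t] Suc.prems unfolding w_def by simp
    qed (use V in auto)
    then obtain a e where "a \<in> X - V" "a + e \<in> X - V" "w (t + 1) \<le> e" "e \<le> w (t + 2)"
      unfolding w_def by auto
    then show "\<exists>a e. a \<in> A - V \<and> a + e \<in> A - V \<and> d dvd e \<and> w (t + 1) \<le> e \<and> e \<le> w (t + 2)"
      using cong[of a e] X(1) by blast
  next
    show "0 < w (t + 1)" using mono[of t] Suc.prems by simp
    show "card U + 2 * ?c \<le> R" using U(4) Suc.prems(2) cost' by auto
  qed (use U in auto)
  then obtain U' where U': "finite U'" "U' \<subseteq> A" "card U' \<le> card U + 2 * ?c"
      "ap_reach d U' (w (t + 2) + ?c * w (t + 1))" by blast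
  have "w (t + 3) \<le> ?c * w (t + 1)"
  proof -
    have "w (t + 1) > 0" using mono[of t] Suc.prems by simp
    then show ?thesis
      using dividend_less_div_times[of "w (t + 1)" "w (t + 3)"] by simp
  qed
  then have "ap_reach d U' (w (Suc t + 2))"
    using ap_reach_mono[OF U'(4), of "w (t + 3)"] by (simp add: numeral_2_eq_2 numeral_3_eq_3)
  moreover have "card U' \<le> 2 * (w 2 div d + 1 + (\<Sum>i=1..Suc t. w (i + 2) div w i + 1))"
  proof -
    have "x \<le> 2 * (a + (b + c))" if "x \<le> y + 2 * c" "y \<le> 2 * (a + b)" for a b c x y :: nat
      using that by presburger
    then show ?thesis unfolding cost' using U'(3) U(4) by blast
  qed
  ultimately show ?case using U' by blast
qed

text \<open>Write \<open>P (i + 2) / P i = 1 + (P (i + 2) - P i) / P i\<close>. Monotonicity allows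
  replacing the last denominator by \<open>P 1\<close>, and the sum telescopes.\<close>

lemma sum_shift_two_ratio_le:
  fixes P :: "nat \<Rightarrow> real"
  assumes "\<And>i. 1 \<le> i \<Longrightarrow> i \<le> t + 1 \<Longrightarrow> P i \<le> P (i + 1)" "P 1 > 0"
  shows "(\<Sum>i=1..t. P (i + 2) / P i) \<le> real t + (P (t + 2) + P (t + 1)) / P 1"
  using assms(1)
proof (induction t)
  case 0
  have "P 1 \<le> P 2" using 0[of 1] by (simp add: numeral_2_eq_2)
  then show ?case using assms(2) by (simp add: numeral_2_eq_2)
next
  case (Suc t)
  have m: "i \<le> t + 2 \<Longrightarrow> P 1 \<le> P (i + 1)" for i
  proof (induction i)
    case (Suc i)
    then show ?case using Suc.prems(1) Suc.IH Suc.prems \<open>\<And>i. 1 \<le> i \<Longrightarrow> i \<le> Suc t + 1 \<Longrightarrow> P i \<le> P (i + 1)\<close>[of "i + 1"]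
      by simp
  qed simp
  have p: "P 1 \<le> P (t + 1)" using m[of t] by simp
  have "P (t + 1) \<le> P (t + 2)" "P (t + 2) \<le> P (t + 3)"
    using Suc.prems[of "t + 1"] Suc.prems[of "t + 2"] by (simp_all add: numeral_2_eq_2 numeral_3_eq_3)
  then have le: "P (t + 1) \<le> P (t + 3)" by linarith
  have "P (t + 3) / P (t + 1) = 1 + (P (t + 3) - P (t + 1)) / P (t + 1)"
    using p assms(2) by (simp add: field_simps)
  also have "\<dots> \<le> 1 + (P (t + 3) - P (t + 1)) / P 1"
    using p le assms(2) by (intro add_left_mono divide_left_mono) auto
  finally have "P (t + 3) / P (t + 1) \<le> 1 + (P (t + 3) - P (t + 1)) / P 1" .
  moreover have "(\<Sum>i=1..t. P (i + 2) / P i) \<le> real t + (P (t + 2) + P (t + 1)) / P 1"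
    using Suc by auto
  moreover have "(\<Sum>i=1..Suc t. P (i + 2) / P i) = (\<Sum>i=1..t. P (i + 2) / P i) + P (t + 3) / P (t + 1)"
    by (simp add: numeral_2_eq_2 numeral_3_eq_3)
  moreover have "Suc t + 2 = t + 3" "Suc t + 1 = t + 2" by simp_all
  ultimately show ?case
    by (simp only: add_divide_distrib diff_divide_distrib of_nat_Suc)
qed

section \<open>Intervals of subset sums of dense sets\<close>

text \<open>If every \<open>d <= 2 * K\<close> failed, deleting the witnesses \<open>V d\<close>, at
  most \<open>2 * K * R\<close> elements in all, would destroy all differences up to
  \<open>2 * K\<close>. Each block of \<open>2 * K + 1\<close> integers would then keep at most one
  element, contradicting density \<open>1 / K\<close>.\<close>

lemma robust_small_difference:
  assumes "A \<subseteq> {1..N}" "K > 0" "N \<le> K * card A" "N > 2 * K * (1 + 2 * K * R)"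
  shows "\<exists>d. 0 < d \<and> d \<le> 2 * K \<and>
    (\<forall>V. finite V \<longrightarrow> card V \<le> R \<longrightarrow> (\<exists>a. a \<in> A - V \<and> a + d \<in> A - V))"
proof (rule ccontr)
  assume "\<not> ?thesis"
  then have "\<forall>d\<in>{1..2*K}. \<exists>V. finite V \<and> card V \<le> R \<and> \<not> (\<exists>a. a \<in> A - V \<and> a + d \<in> A - V)"
    by (metis atLeastAtMost_iff gr0I not_one_le_zero)
  then obtain V where V: "\<And>d. d \<in> {1..2*K} \<Longrightarrow> finite (V d) \<and> card (V d) \<le> R \<and> \<not> (\<exists>a. a \<in> A - V d \<and> a + d \<in> A - V d)"
    by metis
  define W where "W = (\<Union>d\<in>{1..2*K}. V d)"
  have finA: "finite A" using assms(1) finite_subset by blast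
  have "finite W" unfolding W_def using V by blast
  have "card W \<le> (\<Sum>d\<in>{1..2*K}. card (V d))" unfolding W_def by (rule card_UN_le) simp
  also have "\<dots> \<le> 2 * K * R" using sum_bounded_above[of "{1..2*K}" "\<lambda>d. card (V d)" R] V by simp
  finally have W: "card W \<le> 2 * K * R" .
  have "inj_on (\<lambda>x. x div (2 * K + 1)) (A - W)"
  proof (rule linorder_inj_onI')
    fix x y assume xy: "x \<in> A - W" "y \<in> A - W" "x < y"
    show "x div (2 * K + 1) \<noteq> y div (2 * K + 1)"
    proof
      assume eq: "x div (2 * K + 1) = y div (2 * K + 1)"
      have "y - x \<le> 2 * K"
      proof -
        have "y = (y div (2*K+1)) * (2*K+1) + y mod (2*K+1)" "x = (y div (2*K+1)) * (2*K+1) + x mod (2*K+1)"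
          by (metis div_mult_mod_eq, metis div_mult_mod_eq eq)
        moreover have "y mod (2*K+1) < 2*K+1" by simp
        ultimately show ?thesis by linarith
      qed
      then have "y - x \<in> {1..2*K}" using xy by simp
      then have "\<not> (x \<in> A - V (y - x) \<and> x + (y - x) \<in> A - V (y - x))" "V (y - x) \<subseteq> W"
        using V unfolding W_def by blast+
      moreover have "x + (y - x) = y" using xy by simp
      ultimately show False using xy by auto
    qed
  qed
  then have "card (A - W) = card ((\<lambda>x. x div (2 * K + 1)) ` (A - W))" by (simp add: card_image)
  also have "\<dots> \<le> card {0..N div (2 * K + 1)}"
    by (rule card_mono) (use assms(1) in \<open>auto intro!: div_le_mono\<close>)
  finally have "card (A - W) \<le> N div (2 * K + 1) + 1" by simp
  then have cA: "card A \<le> N div (2 * K + 1) + 1 + 2 * K * R"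
    using W diff_card_le_card_Diff[OF \<open>finite W\<close>, of A] by linarith
  have "N \<le> K * (N div (2 * K + 1) + 1 + 2 * K * R)" using assms(3) cA by (meson le_trans mult_le_mono2)
  then have "2 * N \<le> 2 * K * (N div (2 * K + 1)) + 2 * K * (1 + 2 * K * R)" by (simp add: algebra_simps)
  moreover have "2 * K * (N div (2 * K + 1)) \<le> (2 * K + 1) * (N div (2 * K + 1))" by simp
  moreover have "(2 * K + 1) * (N div (2 * K + 1)) \<le> N" by (rule times_div_less_eq_dividend)
  ultimately show False using assms(4) by linarith
qed

text \<open>To be applied to a most populated class \<open>X\<close> modulo \<open>d\<close>, with
  \<open>h\<close> the number of populated classes. Climbing to the width at the top scale costs
  \<open>O(K + Lam)\<close> pairs; repeated pairs at the top scale then reach \<open>L * N\<close>,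
  the room needed for correcting residues.\<close>

lemma long_ap_reach:
  fixes A X :: "nat set" and N d K h R Lam L :: nat
  assumes X: "X \<subseteq> A" "A \<subseteq> {1..N}" and d: "d > 0"
    and cong: "\<And>x e. x \<in> X \<Longrightarrow> x + e \<in> X \<Longrightarrow> d dvd e"
    and base: "\<And>V. finite V \<Longrightarrow> card V \<le> R \<Longrightarrow> \<exists>a. a \<in> A - V \<and> a + d \<in> A - V"
    and h: "h \<le> d" "N \<le> 2 * h * K * card X" "L * h \<le> 13 * d"
    and b: "8 \<le> card X" "2 * Lam * R \<le> card X"
    and Lam: "N \<le> 2 ^ Lam" and R: "1160 * (K + Lam) \<le> R" and K: "K > 0"
  shows "\<exists>U. finite U \<and> U \<subseteq> A \<and> card U \<le> 1160 * (K + Lam) \<and> ap_reach d U (L * N)"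
proof -
  define b where "b = card X"
  have XN: "X \<subseteq> {1..N}" using X by blast
  have bN: "b \<le> N" unfolding b_def using card_mono[OF _ XN] by simp
  \<comment> \<open>A cluster of \<open>2 ^ I\<close> elements takes at most half of
    \<open>X\<close>; the other half covers the deletion budget \<open>I * R\<close>.\<close>
  obtain I where I: "2 ^ I \<le> b div 2" "b div 2 < 2 ^ (I + 1)"
  proof -
    have "1 \<le> b div 2" using b(1) unfolding b_def by linarith
    then show ?thesis using ex_power_ivl1[of 2 "b div 2"] that by auto
  qed
  have b4: "b < 4 * 2 ^ I" using I(2) by simp
  have I2: "2 \<le> I"
  proof (rule ccontr)
    assume "\<not> 2 \<le> I"
    then have "(2::nat) ^ (I + 1) \<le> 2 ^ 2" by (intro power_increasing) auto
    then show False using I(2) b(1) unfolding b_def by simp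
  qed
  have ILam: "I \<le> Lam"
  proof -
    have "(2::nat) ^ I \<le> 2 ^ Lam" using I(1) bN Lam by linarith
    then show ?thesis by (simp add: power_increasing_iff)
  qed
  have card: "I * R + 2 ^ I \<le> card X"
  proof -
    have "I * R \<le> Lam * R" using ILam by simp
    then show ?thesis using I(1) b(2) unfolding b_def by linarith
  qed
  define w where "w = (\<lambda>i. robust_width X (i * R) (2 ^ i))"
  have fits: "i * R + 2 ^ i \<le> card X" if "i \<le> I" for i
  proof -
    have "i * R \<le> I * R" "(2::nat) ^ i \<le> 2 ^ I" using that by (auto intro: power_increasing)
    then show ?thesis using card by linarith
  qed
  have dbl: "2 * w i \<le> w (i + 1)" if "i + 1 \<le> I" for i
    unfolding w_def using robust_width_double[OF XN, of "i * R" "(i + 1) * R" "2 ^ i"] fits[OF that] by simp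
  have w1: "d \<le> w 1"
  proof -
    have "narrow_in X (2 ^ 1) (w 1) {}"
      unfolding w_def by (rule robust_width_bounds(2)[OF XN]) (use fits[of 1] I2 in auto)
    then obtain Y where Y: "Y \<subseteq> X" "card Y = 2" "\<forall>y\<in>Y. \<forall>z\<in>Y. z \<le> y + w 1"
      unfolding narrow_in_def by auto
    then obtain y z where yz: "y \<in> Y" "z \<in> Y" "y < z"
      by (metis card_2_iff insertI1 insert_commute nat_neq_iff)
    then have "d dvd z - y" using cong[of y "z - y"] Y(1) by auto
    then have "d \<le> z - y" using yz by (intro dvd_imp_le) auto
    then show ?thesis using Y(3) yz by fastforce
  qed
  have wlow: "2 ^ i * d \<le> w (i + 1)" if "i + 1 \<le> I" for i
    using that
  proof (induction i)
    case 0 then show ?case using w1 by simp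
  next
    case (Suc i) then show ?case using dbl[of "i + 1"] by simp
  qed
  have wI: "w I \<le> N" unfolding w_def using robust_width_bounds(1)[OF XN fits] by simp
  have NI: "N \<le> 8 * h * K * 2 ^ I"
  proof -
    have "2 * h * K * b \<le> 2 * h * K * (4 * 2 ^ I)" using b4 by (intro mult_left_mono) auto
    also have "\<dots> = 8 * h * K * 2 ^ I" by simp
    finally show ?thesis using h(2) unfolding b_def by (rule order_trans[rotated])
  qed
  \<comment> \<open>The normalised width is nondecreasing and, for \<open>i\<close> from
    \<open>1\<close> to \<open>I\<close>, lies between \<open>d / 2\<close> and
    \<open>8 * d * K\<close>. This bounds the number of pairs.\<close>
  define P where "P = (\<lambda>i. real (w i) / 2 ^ i)"
  have Pm: "P i \<le> P (i + 1)" if "i + 1 \<le> I" for i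
  proof -
    have "2 * real (w i) \<le> real (w (i + 1))" using dbl[OF that] by linarith
    then show ?thesis unfolding P_def by (simp add: field_simps)
  qed
  have P1: "real d / 2 \<le> P 1" using w1 unfolding P_def by simp
  have Pmono: "P i \<le> P j" if "i \<le> j" "j \<le> I" for i j
    using that(1,2)
  proof (induction j rule: dec_induct)
    case (step j) then show ?case using Pm[of j] by simp
  qed simp
  have PI: "P I \<le> 8 * real d * real K"
  proof -
    have "real (w I) \<le> real (8 * h * K * 2 ^ I)" using wI NI by linarith
    also have "\<dots> \<le> 8 * real d * real K * 2 ^ I" using h(1) by (simp add: mult_right_mono)
    finally show ?thesis unfolding P_def by (simp add: field_simps)
  qed
  have dpos: "real d > 0" using d by simp
  have w2: "w 2 div d \<le> 32 * K"
  proof -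
    have "P 2 \<le> 8 * real d * real K" using Pmono[of 2 I] I2 PI by simp
    then have "real (w 2) \<le> real (32 * K * d)" unfolding P_def by (simp add: mult_ac)
    then have "w 2 \<le> 32 * K * d" by linarith
    then show ?thesis using d by (metis div_le_mono nonzero_mult_div_cancel_right not_gr0)
  qed
  define t where "t = I - 2"
  have t: "t + 2 = I" using I2 by (simp add: t_def)
  have wpos: "w i > 0" if "1 \<le> i" "i \<le> I" for i
  proof -
    have "2 ^ (i - 1) * d \<le> w i" using wlow[of "i - 1"] that by simp
    moreover have "0 < 2 ^ (i - 1) * d" using d by simp
    ultimately show ?thesis by linarith
  qed
  \<comment> \<open>The factor \<open>4\<close> is \<open>2 ^ (i + 2) / 2 ^ i\<close>, and the
    telescoped part contributes \<open>2 * (8 * d * K) / (d / 2) = 32 * K\<close>.\<close>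
  have sumw: "(\<Sum>i=1..t. w (i + 2) div w i + 1) \<le> 5 * I + 128 * K"
  proof -
    have "real (\<Sum>i=1..t. w (i + 2) div w i + 1) \<le> (\<Sum>i=1..t. 4 * (P (i + 2) / P i) + 1)"
      unfolding of_nat_sum
    proof (rule sum_mono)
      fix i assume "i \<in> {1..t}"
      then have "w i > 0" using wpos t by simp
      have "real (w (i + 2) div w i) \<le> real (w (i + 2)) / real (w i)" by (rule of_nat_div_le_of_nat)
      also have "\<dots> = 4 * (P (i + 2) / P i)" unfolding P_def using \<open>w i > 0\<close> by (simp add: field_simps)
      finally show "real (w (i + 2) div w i + 1) \<le> 4 * (P (i + 2) / P i) + 1" by simp
    qed
    also have "\<dots> = 4 * (\<Sum>i=1..t. P (i + 2) / P i) + real t"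
      by (simp add: sum.distrib sum_distrib_left)
    also have "(\<Sum>i=1..t. P (i + 2) / P i) \<le> real t + (P (t + 2) + P (t + 1)) / P 1"
      by (rule sum_shift_two_ratio_le) (use Pm t P1 dpos in auto)
    also have "(P (t + 2) + P (t + 1)) / P 1 \<le> (8 * real d * real K + 8 * real d * real K) / (real d / 2)"
      using PI Pmono[of "t + 1" I] P1 dpos t by (intro frac_le add_mono add_nonneg_nonneg) auto
    also have "\<dots> = 32 * real K" using dpos by (simp add: field_simps)
    finally have "real (\<Sum>i=1..t. w (i + 2) div w i + 1) \<le> 4 * (real t + 32 * real K) + real t" by simp
    then have "real (\<Sum>i=1..t. w (i + 2) div w i + 1) \<le> real (5 * I + 128 * K)" using t by simp
    then show ?thesis by linarith
  qed
  have cost: "2 * (w 2 div d + 1 + (\<Sum>i=1..t. w (i + 2) div w i + 1)) \<le> 322 * K + 10 * Lam"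
  proof -
    have "w 2 div d + 1 + (\<Sum>i=1..t. w (i + 2) div w i + 1) \<le> 32 * K + 1 + (5 * I + 128 * K)"
      using w2 sumw by (intro add_mono) auto
    moreover have "2 * z \<le> 322 * K + 10 * Lam" if "z \<le> 32 * K + 1 + (5 * I + 128 * K)" for z
      using that ILam K by linarith
    ultimately show ?thesis by blast
  qed
  have "\<exists>U. finite U \<and> U \<subseteq> A \<and> ap_reach d U (w (t + 2)) \<and>
      card U \<le> 2 * (w 2 div d + 1 + (\<Sum>i=1..t. w (i + 2) div w i + 1))"
    unfolding w_def
    by (rule ap_reach_chain[OF X d cong base card]) (use wpos[of 1] I2 t cost R in \<open>auto simp: w_def\<close>)
  then obtain U where U0: "finite U" "U \<subseteq> A" "ap_reach d U (w (t + 2))"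
      "card U \<le> 2 * (w 2 div d + 1 + (\<Sum>i=1..t. w (i + 2) div w i + 1))"
    by blast
  have U: "finite U" "U \<subseteq> A" "ap_reach d U (w I)" "card U \<le> 322 * K + 10 * Lam"
    using U0(1,2,3) order_trans[OF U0(4) cost] by (simp_all only: t)
  \<comment> \<open>Here \<open>416 = 13 * 8 * 4\<close>: the target \<open>L * N\<close> is at most
    \<open>13 * d * 8 * K * 2 ^ I\<close>, and each pair gains at least
    \<open>w (t + 1) >= 2 ^ t * d\<close>, where \<open>2 ^ I = 4 * 2 ^ t\<close>.\<close>
  have "\<exists>U'. finite U' \<and> U' \<subseteq> A \<and> card U' \<le> card U + 2 * (416 * K) \<and>
      ap_reach d U' (w I + 416 * K * w (t + 1))"
  proof (rule ap_reach_steps[where R = R and hi = "w I"])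
    fix V :: "nat set" assume V: "finite V" "card V \<le> R"
    have "\<exists>a e. a \<in> X - V \<and> a + e \<in> X - V \<and> robust_width X ((t + 1) * R) (2 ^ (t + 1)) \<le> e \<and>
        e \<le> robust_width X (I * R) (2 * 2 ^ (t + 1))"
    proof (rule robust_width_pair[where Rb = R])
      show "I * R + 2 * 2 ^ (t + 1) \<le> card X" using card t by auto
      show "0 < robust_width X ((t + 1) * R) (2 ^ (t + 1))" using wpos[of "t + 1"] t unfolding w_def by simp
      show "(t + 1) * R + R \<le> I * R" using t by (auto simp: algebra_simps)
    qed (use V XN in auto)
    moreover have "(2::nat) * 2 ^ (t + 1) = 2 ^ I" using t by auto
    ultimately obtain a e where "a \<in> X - V" "a + e \<in> X - V" "w (t + 1) \<le> e" "e \<le> w I"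
      unfolding w_def by auto
    then show "\<exists>a e. a \<in> A - V \<and> a + e \<in> A - V \<and> d dvd e \<and> w (t + 1) \<le> e \<and> e \<le> w I"
      using cong[of a e] X(1) by blast
  next
    show "0 < w (t + 1)" using wpos[of "t + 1"] t by simp
    show "card U + 2 * (416 * K) \<le> R" using U(4) R unfolding add_mult_distrib2 by linarith
  qed (use U in auto)
  then obtain U' where U': "finite U'" "U' \<subseteq> A" "card U' \<le> card U + 2 * (416 * K)"
      "ap_reach d U' (w I + 416 * K * w (t + 1))" by blast
  have "L * N \<le> 416 * K * w (t + 1)"
  proof -
    have "L * N \<le> L * (8 * h * K * 2 ^ I)" using NI by simp
    also have "\<dots> = (L * h) * (8 * K * 2 ^ I)" by simp
    also have "\<dots> \<le> (13 * d) * (8 * K * 2 ^ I)" using h(3) by (rule mult_right_mono) simp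
    also have "\<dots> = 416 * K * (2 ^ t * d)" by (simp add: t[symmetric])
    also have "\<dots> \<le> 416 * K * w (t + 1)" using wlow[of t] t by (intro mult_left_mono) auto
    finally show ?thesis .
  qed
  then have "ap_reach d U' (L * N)" using ap_reach_mono[OF U'(4)] by simp
  moreover have "card U' \<le> 1160 * (K + Lam)" using U'(3) U(4) unfolding add_mult_distrib2 by linarith
  ultimately show ?thesis using U' by blast
qed

text \<open>Add or remove the required number of elements, each at most \<open>N\<close>; as
  \<open>E\<close> is twice as large as \<open>B\<close>, both signs of \<open>f\<close> have room.
  If \<open>E\<close> lies in one residue class, this changes the residue of the sum in a controlled
  way.\<close>

lemma resize_subset_sum_diff:
  fixes f :: int
  assumes "E \<subseteq> {1..N}" "B \<subseteq> E" "card B = k" "card E = 2 * k" "\<bar>f\<bar> \<le> int k"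
  shows "\<exists>F\<subseteq>E. int (card F) = int k + f \<and> \<bar>int (\<Sum>F) - int (\<Sum>B)\<bar> \<le> \<bar>f\<bar> * int N"
proof -
  have fin: "finite E" using assms(1) finite_subset by blast
  have le: "\<Sum>G \<le> card G * N" if "G \<subseteq> E" for G
    using subset_sums_le_card_mult[of "\<Sum>G" G N] that assms(1) by (auto simp: subset_sums_def)
  show ?thesis
  proof (cases "f \<ge> 0")
    case True
    have "nat f \<le> card (E - B)"
      using card_Diff_subset[of B E] assms fin finite_subset[OF assms(2) fin] True by auto
    then obtain G where G: "G \<subseteq> E - B" "card G = nat f" using obtain_subset_with_card_n by metis
    have fG: "finite G" "finite B" using G(1) fin assms(2) by (meson finite_Diff finite_subset)+
    have BG: "B \<inter> G = {}" using G(1) by blast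
    have "\<Sum>(B \<union> G) = \<Sum>B + \<Sum>G" "card (B \<union> G) = k + nat f"
      using sum.union_disjoint[OF fG(2,1) BG] card_Un_disjoint[OF fG(2,1) BG] G(2) assms(3) by auto
    moreover have "int (\<Sum>G) \<le> \<bar>f\<bar> * int N"
    proof -
      have "\<Sum>G \<le> nat f * N" using le[of G] G by auto
      then have "int (\<Sum>G) \<le> int (nat f * N)" by (rule of_nat_mono)
      then show ?thesis using True by simp
    qed
    ultimately show ?thesis
      using G(1) assms(2) True by (intro exI[of _ "B \<union> G"] conjI) (auto simp del: of_nat_sum)
  next
    case False
    then have "nat (- f) \<le> card B" using assms by simp
    then obtain G where G: "G \<subseteq> B" "card G = nat (- f)" using obtain_subset_with_card_n by metis
    have fB: "finite B" "finite G" using G(1) fin assms(2) by (meson finite_subset)+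
    have "\<Sum>B = \<Sum>(B - G) + \<Sum>G" using sum.subset_diff[OF G(1) fB(1)] by simp
    moreover have "card (B - G) = k - nat (- f)" using card_Diff_subset[OF fB(2) G(1)] G(2) assms(3) by simp
    moreover have "int (\<Sum>G) \<le> \<bar>f\<bar> * int N"
    proof -
      have "\<Sum>G \<le> nat (- f) * N" using le[of G] G assms(2) by auto
      then have "int (\<Sum>G) \<le> int (nat (- f) * N)" by (rule of_nat_mono)
      then show ?thesis using False by simp
    qed
    ultimately show ?thesis
      using False assms by (intro exI[of _ "B - G"] conjI) (auto simp del: of_nat_sum)
  qed
qed

text \<open>Each class in \<open>S\<close> reserves \<open>2 * k\<close> elements outside
  \<open>U\<close>, of which \<open>k\<close> are chosen at first. To hit \<open>y\<close>, change
  these numbers by a short signed representation of the missing residue; this moves the sum by at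
  most \<open>k * N\<close>, and a multiple of \<open>d\<close> within the progression remains. The
  length \<open>(2 * k + 1) * N\<close> covers an error of \<open>k * N\<close> on either side and
  the interval itself.\<close>

lemma interval_from_ap_reach:
  fixes A U S :: "nat set" and d N l :: nat
  defines "k \<equiv> 3 * (d div card S + 1)"
  assumes "ap_reach d U l" "finite U" "U \<subseteq> A" "A \<subseteq> {1..N}" and d: "d > 0"
    and S: "S \<subseteq> {..<d}" "S \<noteq> {}" "\<And>q. prime q \<Longrightarrow> q dvd d \<Longrightarrow> \<exists>s\<in>S. \<not> q dvd s"
    and thick: "\<And>s. s \<in> S \<Longrightarrow> card U + 2 * k \<le> card {a\<in>A. a mod d = s}"
    and l: "(2 * k + 1) * N \<le> l"
  shows "\<exists>U' x. finite U' \<and> U' \<subseteq> A \<and> card U' \<le> card U + 2 * k * card S \<and> {x..x+N} \<subseteq> subset_sums U'"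
proof -
  have finS: "finite S" using S(1) finite_subset by blast
  have finA: "finite A" using assms(5) finite_subset by blast
  have "\<exists>E. E \<subseteq> {a\<in>A. a mod d = s} - U \<and> card E = 2 * k" if "s \<in> S" for s
    using diff_card_le_card_Diff[OF assms(3), of "{a\<in>A. a mod d = s}"] thick[OF that]
    by (metis (no_types, lifting) add_leD2 add_le_imp_le_diff add.commute le_trans obtain_subset_with_card_n)
  then obtain E where E: "\<And>s. s \<in> S \<Longrightarrow> E s \<subseteq> {a\<in>A. a mod d = s} - U" "\<And>s. s \<in> S \<Longrightarrow> card (E s) = 2 * k"
    by metis
  have "\<exists>B. B \<subseteq> E s \<and> card B = k" if "s \<in> S" for s
    using E(2)[OF that] by (metis le_add1 mult_2 obtain_subset_with_card_n)
  then obtain B where B: "\<And>s. s \<in> S \<Longrightarrow> B s \<subseteq> E s" "\<And>s. s \<in> S \<Longrightarrow> card (B s) = k" by metis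
  have EN: "E s \<subseteq> {1..N}" "finite (E s)" if "s \<in> S" for s
  proof -
    have "E s \<subseteq> A" using E(1)[OF that] by blast
    then show "E s \<subseteq> {1..N}" "finite (E s)" using assms(5) finA finite_subset by blast+
  qed
  define Z where "Z = (\<Union>s\<in>S. E s)"
  have Z: "finite Z" "Z \<subseteq> A" "U \<inter> Z = {}" unfolding Z_def using finS EN E(1) by blast+
  have cZ: "card Z \<le> 2 * k * card S"
  proof -
    have "card Z \<le> (\<Sum>s\<in>S. card (E s))" unfolding Z_def by (rule card_UN_le[OF finS])
    also have "\<dots> = 2 * k * card S" using E(2) by simp
    finally show ?thesis .
  qed
  have disj: "E s \<inter> E t = {}" if "s \<in> S" "t \<in> S" "s \<noteq> t" for s t
    using E(1)[OF that(1)] E(1)[OF that(2)] that(3) by blast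
  have modE: "int (\<Sum>F) mod int d = (int (card F) * int s) mod int d" if "F \<subseteq> E s" "s \<in> S" for F s
  proof -
    have fF: "finite F" using that EN(2) finite_subset by blast
    have "(\<Sum>a\<in>F. a) mod d = (\<Sum>a\<in>F. a mod d) mod d" by (rule mod_sum_eq[symmetric])
    also have "(\<Sum>a\<in>F. a mod d) = (\<Sum>a\<in>F. s)" by (rule sum.cong) (use that E(1) in blast)+
    finally have "\<Sum>F mod d = (card F * s) mod d" by simp
    then show ?thesis by (metis of_nat_mod of_nat_mult)
  qed
  obtain x0 where x0: "\<And>j. j * d \<le> l \<Longrightarrow> x0 + j * d \<in> subset_sums U"
    using assms(2) unfolding ap_reach_def by blast
  \<comment> \<open>The offset \<open>k * N\<close> keeps the part left to the progression
    nonnegative even for the largest correction.\<close>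
  define x where "x = x0 + (\<Sum>s\<in>S. \<Sum>(B s)) + k * N"
  have "y \<in> subset_sums (U \<union> Z)" if y: "y \<in> {x..x+N}" for y
  proof -
    define v where "v = int y - int x0 - (\<Sum>s\<in>S. int (\<Sum>(B s)))"
    have "v mod int d \<in> signed_residues d S k"
      unfolding k_def using signed_residues_full[OF d S] d by simp
    then obtain f where f: "v mod int d = (\<Sum>s\<in>S. f s * int s) mod int d" "(\<Sum>s\<in>S. \<bar>f s\<bar>) \<le> int k"
      unfolding signed_residues_def by blast
    have fk: "\<bar>f s\<bar> \<le> int k" if "s \<in> S" for s
      using member_le_sum[of s S "\<lambda>s. \<bar>f s\<bar>"] finS f(2) that by simp
    have "\<exists>F\<subseteq>E s. int (card F) = int k + f s \<and> \<bar>int (\<Sum>F) - int (\<Sum>(B s))\<bar> \<le> \<bar>f s\<bar> * int N" if "s \<in> S" for s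
      using resize_subset_sum_diff[OF EN(1) B(1) B(2) E(2) fk] that by blast
    then obtain F where F: "\<And>s. s \<in> S \<Longrightarrow> F s \<subseteq> E s" "\<And>s. s \<in> S \<Longrightarrow> int (card (F s)) = int k + f s"
        "\<And>s. s \<in> S \<Longrightarrow> \<bar>int (\<Sum>(F s)) - int (\<Sum>(B s))\<bar> \<le> \<bar>f s\<bar> * int N"
      by metis
    define D where "D = (\<Sum>s\<in>S. int (\<Sum>(F s)) - int (\<Sum>(B s)))"
    have "\<bar>D\<bar> \<le> (\<Sum>s\<in>S. \<bar>f s\<bar> * int N)"
      unfolding D_def by (rule order_trans[OF sum_abs sum_mono]) (use F(3) in auto)
    also have "\<dots> = (\<Sum>s\<in>S. \<bar>f s\<bar>) * int N" by (simp add: sum_distrib_right)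
    also have "\<dots> \<le> int k * int N" using f(2) by (rule mult_right_mono) simp
    finally have D: "\<bar>D\<bar> \<le> int (k * N)" by simp
    have "D mod int d = (\<Sum>s\<in>S. (int (\<Sum>(F s)) - int (\<Sum>(B s))) mod int d) mod int d"
      unfolding D_def by (rule mod_sum_eq[symmetric])
    also have "(\<Sum>s\<in>S. (int (\<Sum>(F s)) - int (\<Sum>(B s))) mod int d) = (\<Sum>s\<in>S. (f s * int s) mod int d)"
    proof (rule sum.cong)
      fix s assume s: "s \<in> S"
      have "(int (\<Sum>(F s)) - int (\<Sum>(B s))) mod int d
          = (int (card (F s)) * int s - int (card (B s)) * int s) mod int d"
        using modE[OF F(1)[OF s] s] modE[OF B(1)[OF s] s] by (rule mod_diff_cong)
      also have "int (card (F s)) * int s - int (card (B s)) * int s = f s * int s"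
        using F(2)[OF s] B(2)[OF s] by (simp add: algebra_simps)
      finally show "(int (\<Sum>(F s)) - int (\<Sum>(B s))) mod int d = (f s * int s) mod int d" .
    qed simp
    also have "(\<Sum>s\<in>S. (f s * int s) mod int d) mod int d = (\<Sum>s\<in>S. f s * int s) mod int d"
      by (rule mod_sum_eq)
    finally have "(v - D) mod int d = 0" using f(1) by (metis mod_diff_cong diff_self mod_0)
    then obtain j where j: "v - D = int d * j" by (metis mod_0_imp_dvd dvdE)
    have v: "int (k * N) \<le> v" "v \<le> int (k * N) + int N"
    proof -
      have "(\<Sum>s\<in>S. int (\<Sum>(B s))) = int (\<Sum>s\<in>S. \<Sum>(B s))" by (rule of_nat_sum[symmetric])
      then have "v = int y - int x0 - int (\<Sum>s\<in>S. \<Sum>(B s))" by (simp only: v_def)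
      then show "int (k * N) \<le> v" "v \<le> int (k * N) + int N"
        using y unfolding x_def atLeastAtMost_iff by linarith+
    qed
    then have vD: "0 \<le> v - D" "v - D \<le> int ((2 * k + 1) * N)" using D by (auto simp: algebra_simps)
    have j0: "j \<ge> 0" using vD(1) d unfolding j by (simp add: zero_le_mult_iff)
    have nj: "int (nat j * d) = v - D" using j j0 by simp
    have "int (nat j * d) \<le> int l" unfolding nj using vD(2) l by linarith
    then have "nat j * d \<le> l" by (simp only: of_nat_le_iff)
    then have 1: "x0 + nat j * d \<in> subset_sums U" by (rule x0)
    have "(\<Sum>s\<in>S. \<Sum>(F s)) = \<Sum>(\<Union>s\<in>S. F s)"
    proof (rule sum.UNION_disjoint[symmetric, OF finS])
      show "\<forall>s\<in>S. finite (F s)" using F(1) EN(2) finite_subset by blast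
      show "\<forall>s\<in>S. \<forall>t\<in>S. s \<noteq> t \<longrightarrow> F s \<inter> F t = {}" using F(1) disj by blast
    qed
    then have 2: "(\<Sum>s\<in>S. \<Sum>(F s)) \<in> subset_sums Z"
      unfolding subset_sums_def Z_def using F(1) by (auto intro!: image_eqI[of _ _ "\<Union>s\<in>S. F s"])
    have "x0 + nat j * d + (\<Sum>s\<in>S. \<Sum>(F s)) \<in> subset_sums (U \<union> Z)"
      by (rule subset_sums_Un[OF assms(3) Z(1,3) 1 2])
    moreover have "int (x0 + nat j * d + (\<Sum>s\<in>S. \<Sum>(F s))) = int y"
    proof -
      have "D = (\<Sum>s\<in>S. int (\<Sum>(F s))) - (\<Sum>s\<in>S. int (\<Sum>(B s)))" unfolding D_def by (rule sum_subtractf)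
      then show ?thesis using nj unfolding v_def by simp
    qed
    ultimately show ?thesis by (metis of_nat_eq_iff)
  qed
  moreover have "card (U \<union> Z) \<le> card U + 2 * k * card S" using card_Un_le[of U Z] cZ by linarith
  ultimately show ?thesis using Z assms(3,4) by (intro exI[of _ "U \<union> Z"] exI[of _ x]) auto
qed

text \<open>Density yields the difference \<open>d <= 2 * K\<close>, a most populated class modulo
  \<open>d\<close> the long progression, and all populated classes fill its gaps. The hypothesis on
  primes makes those classes generate the residues modulo \<open>d\<close>.\<close>

lemma subset_sums_interval:
  fixes A :: "nat set" and N K Lam T :: nat
  assumes A: "A \<subseteq> {1..N}" "N \<le> K * card A" and K: "K > 0" and Lam: "Lam > 0" "N \<le> 2 ^ Lam"
    and N: "20000 * (K + Lam) ^ 4 \<le> N" and T: "3000 * (K + Lam) ^ 2 \<le> T"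
    and robust: "\<And>q. prime q \<Longrightarrow> T \<le> card {a\<in>A. \<not> q dvd a}"
  shows "\<exists>U x. finite U \<and> U \<subseteq> A \<and> card U \<le> 1200 * (K + Lam) \<and> {x..x+N} \<subseteq> subset_sums U"
proof -
  define Q where "Q = K + Lam"
  define R where "R = 1200 * Q"
  have KQ: "K < Q" "Lam < Q" "Q > 0" using K Lam by (auto simp: Q_def)
  have finA: "finite A" using A(1) finite_subset by blast
  have QQ: "K * K \<le> Q * Q" "Lam * Q \<le> Q * Q" "K * Q \<le> Q * Q" using KQ by (auto intro: mult_le_mono)
  have N': "20000 * (Q * Q) * (Q * Q) \<le> N" using N by (simp add: Q_def power4_eq_xxxx mult_ac)
  have QQ1: "Q \<le> Q * Q" "1 \<le> Q * Q" using KQ by auto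
  have "2 * K * (1 + 2 * K * R) < N"
  proof -
    have "2 * K * (1 + 2 * K * R) = 2 * K + 4800 * (K * K) * Q" by (simp add: R_def algebra_simps)
    also have "\<dots> \<le> 2 * Q + 4800 * (Q * Q) * Q" using KQ QQ by (intro add_mono mult_mono) auto
    also have "\<dots> \<le> 2 * ((Q * Q) * (Q * Q)) + 4800 * (Q * Q) * (Q * Q)"
      using QQ1 by (intro add_mono mult_left_mono) (auto intro: order_trans)
    also have "\<dots> < 20000 * (Q * Q) * (Q * Q)" using KQ by simp
    finally show ?thesis using N' by linarith
  qed
  then obtain d where d: "0 < d" "d \<le> 2 * K"
      "\<And>V. finite V \<Longrightarrow> card V \<le> R \<Longrightarrow> \<exists>a. a \<in> A - V \<and> a + d \<in> A - V"
    using robust_small_difference[OF A(1) K A(2), of R] by blast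
  define cl where "cl s = {a\<in>A. a mod d = s}" for s
  \<comment> \<open>The other classes hold at most \<open>d * R\<close> elements together, which is
    at most half of \<open>A\<close> and less than \<open>T\<close>.\<close>
  define S where "S = {s. s < d \<and> R \<le> card (cl s)}"
  have S: "S \<subseteq> {..<d}" by (auto simp: S_def)
  have finS: "finite S" by (rule finite_subset[OF S]) simp
  define thin where "thin = (\<Union>s\<in>{..<d} - S. cl s)"
  have dR: "d * R \<le> 2400 * (K * Q)" using d(2) by (simp add: R_def)
  have thin: "card thin \<le> d * R"
  proof -
    have "card thin \<le> (\<Sum>s\<in>{..<d}-S. card (cl s))" unfolding thin_def by (rule card_UN_le) simp
    also have "\<dots> \<le> of_nat (card ({..<d} - S)) * R"
      by (rule sum_bounded_above) (auto simp: S_def)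
    also have "\<dots> = card ({..<d} - S) * R" by simp
    also have "\<dots> \<le> d * R" using card_mono[of "{..<d}" "{..<d} - S"] by auto
    finally show ?thesis .
  qed
  have finthin: "finite thin" unfolding thin_def cl_def using finA by auto
  have Asub: "A \<subseteq> thin \<union> (\<Union>s\<in>S. cl s)" unfolding thin_def cl_def using d(1) by auto
  have bigA: "2 * (d * R) \<le> card A"
  proof -
    have "2 * (d * R) \<le> 4800 * (K * Q)" using dR by linarith
    then have "K * (2 * (d * R)) \<le> K * (4800 * (K * Q))" by (rule mult_left_mono) simp
    also have "\<dots> = 4800 * (K * K) * Q" by simp
    also have "\<dots> \<le> 4800 * (Q * Q) * (Q * Q)" using QQ QQ1 by (intro mult_mono) auto
    also have "\<dots> \<le> 20000 * (Q * Q) * (Q * Q)" by simp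
    also have "\<dots> \<le> K * card A" using N' A(2) by linarith
    finally show ?thesis using K by simp
  qed
  have dRpos: "d * R > 0" using d KQ by (simp add: R_def)
  have Sne: "S \<noteq> {}"
  proof
    assume "S = {}"
    then have "card A \<le> card thin" using Asub finthin by (intro card_mono) auto
    then show False using thin bigA dRpos by linarith
  qed
  \<comment> \<open>If \<open>q\<close> divided all of \<open>S\<close>, every element of
    \<open>A\<close> not divisible by \<open>q\<close> would lie in a thin class, and there are too
    few of those.\<close>
  have gen: "\<exists>s\<in>S. \<not> q dvd s" if q: "prime q" "q dvd d" for q
  proof (rule ccontr)
    assume no: "\<not> ?thesis"
    have "{a\<in>A. \<not> q dvd a} \<subseteq> thin"
    proof
      fix a assume a: "a \<in> {a\<in>A. \<not> q dvd a}"
      then have "\<not> q dvd a mod d" using q(2) by (simp add: dvd_mod_iff)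
      then have "a mod d \<notin> S" using no by blast
      then show "a \<in> thin" unfolding thin_def cl_def using a d(1) by auto
    qed
    then have "card {a\<in>A. \<not> q dvd a} \<le> d * R" using card_mono[OF finthin] thin by (meson le_trans)
    then have "T \<le> 2400 * (K * Q)" using robust[OF q(1)] dR by linarith
    moreover have "2400 * (K * Q) < 3000 * (Q * Q)" using QQ(3) QQ1(2) by linarith
    moreover have "3000 * (Q * Q) \<le> T" using T by (simp only: Q_def power2_eq_square)
    ultimately show False by linarith
  qed
  define h where "h = card S"
  have h: "0 < h" "h \<le> d" using Sne finS card_mono[OF _ S] by (auto simp: h_def card_gt_0_iff)
  obtain c where c: "c \<in> S" "\<And>s. s \<in> S \<Longrightarrow> card (cl s) \<le> card (cl c)"
  proof -
    have "Max ((\<lambda>s. card (cl s)) ` S) \<in> (\<lambda>s. card (cl s)) ` S" using finS Sne by (intro Max_in) auto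
    then obtain c where "c \<in> S" "Max ((\<lambda>s. card (cl s)) ` S) = card (cl c)" by blast
    moreover have "card (cl s) \<le> Max ((\<lambda>s. card (cl s)) ` S)" if "s \<in> S" for s using finS that by auto
    ultimately show ?thesis using that by metis
  qed
  define X where "X = cl c"
  have XA: "X \<subseteq> A" by (auto simp: X_def cl_def)
  have cA: "card A \<le> d * R + h * card X"
  proof -
    have "card A \<le> card (thin \<union> (\<Union>s\<in>S. cl s))"
      using Asub finthin finS finA by (intro card_mono) (auto simp: cl_def)
    also have "\<dots> \<le> card thin + card (\<Union>s\<in>S. cl s)" by (rule card_Un_le)
    also have "card (\<Union>s\<in>S. cl s) \<le> (\<Sum>s\<in>S. card (cl s))" by (rule card_UN_le[OF finS])
    also have "\<dots> \<le> h * card X" using sum_bounded_above[of S "\<lambda>s. card (cl s)" "card X"] c(2) by (simp add: h_def X_def)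
    finally show ?thesis using thin by linarith
  qed
  have NX: "N \<le> 2 * h * K * card X"
  proof -
    have "card A \<le> 2 * (h * card X)" using cA bigA by linarith
    then have "K * card A \<le> K * (2 * (h * card X))" by (rule mult_left_mono) simp
    also have "\<dots> = 2 * h * K * card X" by simp
    finally show ?thesis using A(2) by linarith
  qed
  \<comment> \<open>Since \<open>h <= d <= 2 * K\<close>, the class \<open>X\<close> has at least
    \<open>N / (4 * K ^ 2)\<close> elements. The fourth power in the bound on \<open>N\<close> thus
    leaves enough for the budget \<open>2 * Lam * R\<close>.\<close>
  have bX: "5000 * (Q * Q) \<le> card X"
  proof -
    have "2 * h * K * card X \<le> 2 * (2 * K) * K * card X" using h(2) d(2) by (intro mult_right_mono mult_left_mono) auto
    also have "\<dots> = 4 * (K * K) * card X" by simp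
    also have "\<dots> \<le> 4 * (Q * Q) * card X" using QQ(1) by (intro mult_right_mono mult_left_mono) auto
    finally have "20000 * (Q * Q) * (Q * Q) \<le> 4 * (Q * Q) * card X" using NX N' by linarith
    then have "(Q * Q) * (5000 * (Q * Q)) \<le> (Q * Q) * card X" by (simp add: mult_ac)
    then show ?thesis using QQ1 by (metis mult_le_cancel1 less_le_trans zero_less_one)
  qed
  define k where "k = 3 * (d div card S + 1)"
  \<comment> \<open>This controls both the required length, through
    \<open>(2 * k + 1) * h <= 13 * d\<close>, and the reserved elements, through
    \<open>2 * k * h <= 24 * K\<close>.\<close>
  have kh: "k * h \<le> 6 * d"
  proof -
    have "k * h = 3 * (d div h * h) + 3 * h" by (simp add: k_def h_def algebra_simps)
    also have "\<dots> \<le> 3 * d + 3 * d" using h(2) by (intro add_mono mult_left_mono) (auto simp: div_times_less_eq_dividend)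
    finally show ?thesis by simp
  qed
  have "\<exists>U. finite U \<and> U \<subseteq> A \<and> card U \<le> 1160 * (K + Lam) \<and> ap_reach d U ((2 * k + 1) * N)"
  proof (rule long_ap_reach[OF XA A(1) d(1) _ d(3) h(2) NX])
    show "d dvd e" if "x \<in> X" "x + e \<in> X" for x e
    proof -
      have "x mod d = (x + e) mod d" using that by (simp add: X_def cl_def)
      then show ?thesis by (metis add_diff_cancel_left' le_add1 mod_eq_dvd_iff_nat)
    qed
    show "(2 * k + 1) * h \<le> 13 * d" using kh h(2) by (simp add: algebra_simps)
    show "8 \<le> card X" using bX QQ1 by linarith
    have "2 * Lam * R = 2400 * (Lam * Q)" by (simp add: R_def)
    then show "2 * Lam * R \<le> card X" using bX QQ(2) by linarith
    show "1160 * (K + Lam) \<le> R" by (simp add: R_def Q_def)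
  qed (use K Lam in auto)
  then obtain U where U: "finite U" "U \<subseteq> A" "card U \<le> 1160 * Q" "ap_reach d U ((2 * k + 1) * N)"
    by (auto simp: Q_def)
  have k12: "k \<le> 12 * K"
  proof -
    have "k \<le> k * h" using h(1) by simp
    then show ?thesis using kh d(2) by linarith
  qed
  have "\<exists>U' x. finite U' \<and> U' \<subseteq> A \<and> card U' \<le> card U + 2 * k * card S \<and> {x..x+N} \<subseteq> subset_sums U'"
    unfolding k_def
  proof (rule interval_from_ap_reach[OF U(4,1,2) A(1) d(1) S Sne gen])
    fix s assume "s \<in> S"
    then have "1200 * Q \<le> card {a \<in> A. a mod d = s}" by (simp add: S_def R_def cl_def)
    then show "card U + 2 * (3 * (d div card S + 1)) \<le> card {a \<in> A. a mod d = s}"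
      using U(3) k12 KQ unfolding k_def by linarith
  qed (auto simp: k_def)
  then obtain U' x where U': "finite U'" "U' \<subseteq> A" "card U' \<le> card U + 2 * k * card S" "{x..x+N} \<subseteq> subset_sums U'"
    by blast
  have "2 * k * card S \<le> 24 * K" using kh d(2) by (simp add: h_def)
  then have "card U' \<le> 1200 * (K + Lam)" using U'(3) U(3) KQ unfolding Q_def add_mult_distrib2 by linarith
  then show ?thesis using U' by blast
qed

text \<open>The interval found in the sums of \<open>U\<close> starts low because \<open>U\<close>
  is small, and the elements of \<open>A - U\<close> extend it up to within
  \<open>card U * N\<close> of the total sum.\<close>

corollary subset_sums_middle:
  fixes A :: "nat set" and N K Lam T :: nat
  assumes A: "A \<subseteq> {1..N}" "N \<le> K * card A" and K: "K > 0" and Lam: "Lam > 0" "N \<le> 2 ^ Lam"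
    and N: "20000 * (K + Lam) ^ 4 \<le> N" and T: "3000 * (K + Lam) ^ 2 \<le> T"
    and robust: "\<And>q. prime q \<Longrightarrow> T \<le> card {a\<in>A. \<not> q dvd a}"
    and y: "1200 * (K + Lam) * N \<le> y" "y + 1200 * (K + Lam) * N \<le> \<Sum>A"
  shows "y \<in> subset_sums A"
proof -
  obtain U x where U: "finite U" "U \<subseteq> A" "card U \<le> 1200 * (K + Lam)" "{x..x+N} \<subseteq> subset_sums U"
    using subset_sums_interval[OF A K Lam N T robust] by blast
  have finA: "finite A" using A(1) finite_subset by blast
  have UN: "U \<subseteq> {1..N}" using U A by blast
  have "card U * N \<le> 1200 * (K + Lam) * N" using U(3) by (rule mult_right_mono) simp
  moreover have "x \<in> subset_sums U" using U(4) by auto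
  ultimately have x: "x \<le> 1200 * (K + Lam) * N" using subset_sums_le_card_mult[OF _ UN] by (meson le_trans)
  have "\<Sum>U \<in> subset_sums U" by (auto simp: subset_sums_def)
  then have sU: "\<Sum>U \<le> 1200 * (K + Lam) * N"
    using subset_sums_le_card_mult[OF _ UN] \<open>card U * N \<le> _\<close> by (meson le_trans)
  have "\<Sum>A = \<Sum>(A - U) + \<Sum>U" using sum.subset_diff[OF U(2) finA] by simp
  then have "y \<in> {x..x+N+\<Sum>(A - U)}" using x sU y by auto
  moreover have "{x..x+N+\<Sum>(A - U)} \<subseteq> subset_sums (U \<union> (A - U))"
    by (rule subset_sums_extend_interval) (use U finA A(1) in auto)
  moreover have "U \<union> (A - U) = A" using U(2) by blast
  ultimately show ?thesis by auto
qed

section \<open>The smallest non-divisor and the upper bound\<close>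

lemma snd_nd_props:
  assumes "m > 0"
  shows "\<not> snd_nd m dvd m" "2 \<le> snd_nd m" "\<And>k. 0 < k \<Longrightarrow> k < snd_nd m \<Longrightarrow> k dvd m"
proof -
  have "0 < Suc m \<and> \<not> Suc m dvd m" using assms by (auto dest: dvd_imp_le)
  then have *: "0 < snd_nd m \<and> \<not> snd_nd m dvd m" unfolding snd_nd_def by (rule LeastI)
  then show "\<not> snd_nd m dvd m" by blast
  show "2 \<le> snd_nd m" using * by (cases "snd_nd m = 1") auto
  show "k dvd m" if "0 < k" "k < snd_nd m" for k
    using not_less_Least[of k "\<lambda>k. 0 < k \<and> \<not> k dvd m"] that unfolding snd_nd_def by blast
qed

text \<open>Adding one more element either enlarges the set of attained residues, or that set is stable
  under translation by a nonzero residue \<open>a\<close>; then it contains the subgroup generated by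
  \<open>gcd a D\<close>, a proper divisor of \<open>D\<close> and hence a divisor of \<open>m\<close>.\<close>
lemma subset_sum_hits_residue:
  fixes D m :: nat and R :: "nat set"
  assumes D: "D > 0" "\<And>k. 0 < k \<Longrightarrow> k < D \<Longrightarrow> k dvd m"
    and R: "finite R" "\<And>a. a \<in> R \<Longrightarrow> \<not> D dvd a" "D \<le> card R + 1"
  shows "\<exists>W\<subseteq>R. \<Sum>W mod D = m mod D"
proof -
  define res where "res R = (\<lambda>x. x mod D) ` subset_sums R" for R
  have sub: "res R \<subseteq> {..<D}" for R using D(1) by (auto simp: res_def)
  have fin: "finite (res R)" for R by (rule finite_subset[OF sub]) simp
  have "m mod D \<in> res R \<or> min D (card R + 1) \<le> card (res R)"
    using R(1,2)
  proof (induction R rule: finite_induct)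
    case empty
    then show ?case by (simp add: res_def subset_sums_def)
  next
    case (insert a R)
    have mono: "res R \<subseteq> res (insert a R)"
      unfolding res_def using subset_sums_mono[of R "insert a R"] by blast
    have shift: "(x + a) mod D \<in> res (insert a R)" if x: "x \<in> res R" for x
    proof -
      obtain z where z: "z \<in> subset_sums R" "x = z mod D" using x by (auto simp: res_def)
      have "z + a \<in> subset_sums (R \<union> {a})"
      proof (rule subset_sums_Un)
        show "a \<in> subset_sums {a}"
          by (auto simp: subset_sums_def image_iff intro!: bexI[of _ "{a}"])
      qed (use z insert.hyps in auto)
      then have "(z + a) mod D \<in> res (insert a R)" by (auto simp: res_def)
      then show ?thesis using z(2) by (simp add: mod_simps)
    qed
    consider "m mod D \<in> res R" | "m mod D \<notin> res R" "res (insert a R) = res R"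
      | "m mod D \<notin> res R" "res (insert a R) \<noteq> res R" by blast
    then show ?case
    proof cases
      case 1 then show ?thesis using mono by blast
    next
      case 2
      have mult: "(j * a) mod D \<in> res R" for j
      proof (induction j)
        case 0
        have "0 \<in> subset_sums R" by (auto simp: subset_sums_def image_iff intro!: bexI[of _ "{}"])
        then show ?case unfolding res_def by (metis image_eqI mod_0 mult_0)
      next
        case (Suc j)
        then have "((j * a) mod D + a) mod D \<in> res R" using shift 2(2) by blast
        then show ?case by (simp add: mod_simps add.commute)
      qed
      have na: "\<not> D dvd a" using insert.prems by simp
      then have "a \<noteq> 0" by (metis dvd_0_right)
      have "gcd a D \<noteq> D" using na by (metis gcd_dvd1)
      moreover have "gcd a D \<le> D" using D(1) by (intro dvd_imp_le) auto
      ultimately have "gcd a D < D" by simp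
      then have "gcd a D dvd m" using D(2) \<open>a \<noteq> 0\<close> by simp
      then obtain j where "[a * j = m] (mod D)" using cong_solve_dvd_nat \<open>a \<noteq> 0\<close> by blast
      then have "(j * a) mod D = m mod D" by (simp add: Cong.cong_def mult.commute)
      then have "m mod D \<in> res R" using mult[of j] by simp
      then show ?thesis using 2 by simp
    next
      case 3
      then have "res R \<subset> res (insert a R)" using mono by blast
      then have "card (res R) < card (res (insert a R))" by (rule psubset_card_mono[OF fin])
      moreover have "min D (card R + 1) \<le> card (res R)" using insert 3 by simp
      moreover have "card (insert a R) = card R + 1" using insert.hyps by simp
      ultimately show ?thesis by linarith
    qed
  qed
  moreover have "m mod D \<in> res R" if "D \<le> card (res R)"
  proof -
    have "res R = {..<D}" using sub[of R] that by (intro card_subset_eq) (auto intro: antisym card_mono[of "{..<D}", simplified])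
    then show ?thesis using D(1) by simp
  qed
  ultimately have "m mod D \<in> res R" using R(3) by (auto simp: min_def split: if_splits)
  then show ?thesis unfolding res_def subset_sums_def by auto
qed

section \<open>Reduction to the multiples of one integer\<close>

lemma sum_distinct_ge:
  assumes "finite A" "0 \<notin> A"
  shows "card A * (card A + 1) \<le> 2 * \<Sum>A"
  using assms
proof (induction "card A" arbitrary: A)
  case 0 then show ?case by simp
next
  case (Suc c)
  then have ne: "A \<noteq> {}" by auto
  define M where "M = Max A"
  have M: "M \<in> A" using Suc ne by (simp add: M_def)
  have "A \<subseteq> {1..M}"
    using Suc.prems by (auto simp: M_def Suc_le_eq) (metis gr0I)
  then have "card A \<le> card {1..M}" by (intro card_mono) auto
  then have cM: "Suc c \<le> M" using Suc by simp
  have c: "card (A - {M}) = c" using Suc M by simp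
  have "c * (c + 1) \<le> 2 * \<Sum>(A - {M})" using Suc.hyps(1)[of "A - {M}"] c Suc.prems by simp
  moreover have "\<Sum>A = M + \<Sum>(A - {M})" using sum.remove[OF Suc.prems(1) M, of "\<lambda>x. x"] by simp
  ultimately show ?case using cM Suc.hyps(2)[symmetric] by simp
qed

lemma card_multiples_le:
  assumes "A \<subseteq> {1..n}" "e > (0::nat)"
  shows "card {a\<in>A. e dvd a} \<le> n div e"
proof -
  have "{a\<in>A. e dvd a} \<subseteq> (\<lambda>j. e * j) ` {1..n div e}"
  proof
    fix a assume a: "a \<in> {a\<in>A. e dvd a}"
    then obtain j where j: "a = e * j" by auto
    have "1 \<le> a" "a \<le> n" using a assms(1) by auto
    then have "j \<in> {1..n div e}" using j assms(2)
      by (metis Suc_leI atLeastAtMost_iff One_nat_def div_le_mono gr0I mult_0_right nonzero_mult_div_cancel_left not_one_le_zero not_gr0)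
    then show "a \<in> (\<lambda>j. e * j) ` {1..n div e}" using j by blast
  qed
  then have "card {a\<in>A. e dvd a} \<le> card ((\<lambda>j. e * j) ` {1..n div e})" by (intro card_mono) auto
  also have "\<dots> \<le> card {1..n div e}" by (rule card_image_le) simp
  finally show ?thesis by simp
qed

text \<open>Division by \<open>e\<close> maps \<open>M\<close> into \<open>{1..n div e}\<close>, and
  failing divisibility by \<open>e * q\<close> becomes failing divisibility by \<open>q\<close>. The
  lower bound on the total sum comes from \<open>card M\<close> through
  \<open>sum_distinct_ge\<close>.\<close>

lemma scaled_subset_sums_middle:
  fixes A :: "nat set" and n e K Lam T y :: nat
  defines "M \<equiv> {a\<in>A. e dvd a}"
  assumes A: "A \<subseteq> {1..n}" and e: "0 < e"
    and robust: "\<And>q. prime q \<Longrightarrow> T \<le> card {a\<in>M. \<not> e * q dvd a}"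
    and n: "n \<le> K * card M" "n \<le> 2 ^ Lam" "20000 * (K + Lam) ^ 4 \<le> n div e"
    and T: "3000 * (K + Lam) ^ 2 \<le> T" and pos: "K > 0" "Lam > 0"
    and y: "e dvd y" "1200 * (K + Lam) * n \<le> y" "2 * (y + 1200 * (K + Lam) * n) \<le> (card M) ^ 2"
  shows "y \<in> subset_sums M"
proof -
  define A' where "A' = (\<lambda>a. a div e) ` M"
  define N where "N = n div e"
  have finM: "finite M" using A finite_subset[of A "{1..n}"] by (auto simp: M_def)
  have inj: "inj_on (\<lambda>a. a div e) M"
    by (rule inj_onI) (metis (no_types, lifting) M_def dvd_div_eq_iff mem_Collect_eq)
  have A': "A' \<subseteq> {1..N}"
  proof
    fix x assume "x \<in> A'"
    then obtain a where a: "a \<in> A" "e dvd a" "x = a div e" by (auto simp: A'_def M_def)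
    then have "1 \<le> a" "a \<le> n" using A by auto
    then have "x \<noteq> 0" using a by (metis dvd_div_eq_0_iff not_one_le_zero)
    then show "x \<in> {1..N}" using a \<open>a \<le> n\<close> by (auto simp: N_def div_le_mono)
  qed
  have cA': "card A' = card M" unfolding A'_def by (rule card_image[OF inj])
  have img: "e * \<Sum>((\<lambda>a. a div e) ` W) = \<Sum>W" if "W \<subseteq> M" for W
  proof -
    have "\<Sum>((\<lambda>a. a div e) ` W) = (\<Sum>a\<in>W. a div e)"
      using sum.reindex[OF inj_on_subset[OF inj that], of "\<lambda>x. x"] by simp
    then have "e * \<Sum>((\<lambda>a. a div e) ` W) = (\<Sum>a\<in>W. e * (a div e))" by (simp add: sum_distrib_left)
    also have "\<dots> = \<Sum>W" by (rule sum.cong) (use that in \<open>auto simp: M_def\<close>)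
    finally show ?thesis .
  qed
  have Ne: "N * e \<le> n" by (simp add: N_def div_times_less_eq_dividend)
  have NQ: "1200 * (K + Lam) * N * e \<le> 1200 * (K + Lam) * n"
    using mult_left_mono[OF Ne, of "1200 * (K + Lam)"] by (simp only: mult.assoc zero_le)
  obtain z where z: "y = e * z" using y(1) by blast
  have "z \<in> subset_sums A'"
  proof (rule subset_sums_middle[OF A' _ pos(1,2)])
    have "N \<le> n" by (simp add: N_def div_le_dividend)
    then show "N \<le> K * card A'" "N \<le> 2 ^ Lam" using n cA' by simp_all
    show "20000 * (K + Lam) ^ 4 \<le> N" using n(3) by (simp add: N_def)
    show "3000 * (K + Lam) ^ 2 \<le> T" by (rule T)
    show "T \<le> card {a \<in> A'. \<not> q dvd a}" if q: "prime q" for q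
    proof -
      have "{a \<in> A'. \<not> q dvd a} = (\<lambda>a. a div e) ` {a\<in>M. \<not> e * q dvd a}"
      proof -
        have "q dvd a div e \<longleftrightarrow> e * q dvd a" if "a \<in> M" for a
          using that e by (auto simp: M_def)
        then show ?thesis unfolding A'_def by (auto intro!: image_eqI)
      qed
      moreover have "inj_on (\<lambda>a. a div e) {a\<in>M. \<not> e * q dvd a}"
        by (rule inj_on_subset[OF inj]) auto
      ultimately show ?thesis using robust[OF q] by (simp add: card_image)
    qed
    have "1200 * (K + Lam) * N * e \<le> z * e" using NQ y(2) z by (simp only: mult.commute[of z e])
    then show "1200 * (K + Lam) * N \<le> z" using e by (simp only: mult_le_cancel2)
    have "card M * (card M + 1) \<le> 2 * \<Sum>M"
      by (rule sum_distinct_ge[OF finM]) (use A in \<open>auto simp: M_def\<close>)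
    then have "card M ^ 2 \<le> 2 * \<Sum>M" by (simp add: power2_eq_square)
    then have "2 * (y + 1200 * (K + Lam) * n) \<le> 2 * \<Sum>M" by (rule order_trans[OF y(3)])
    then have "y + 1200 * (K + Lam) * n \<le> \<Sum>M" by simp
    also have "\<Sum>M = e * \<Sum>A'" using img[of M] by (simp add: A'_def)
    finally have "e * (z + 1200 * (K + Lam) * N) \<le> e * \<Sum>A'"
      using NQ z by (simp add: add_mult_distrib2 mult_ac)
    then show "z + 1200 * (K + Lam) * N \<le> \<Sum>A'" using e by (simp only: mult_le_cancel1)
  qed
  then obtain W where W: "W \<subseteq> A'" "z = \<Sum>W" by (auto simp: subset_sums_def)
  then obtain V where V: "V \<subseteq> M" "W = (\<lambda>a. a div e) ` V" unfolding A'_def by (meson subset_imageE)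
  then have "y = \<Sum>V" using z W(2) img[of V] by simp
  then show ?thesis using V(1) by (auto simp: subset_sums_def)
qed

lemma subset_sums_hits:
  fixes A :: "nat set" and n m E K Lam T :: nat
  assumes A: "A \<subseteq> {1..n}" and m: "m > 0"
    and E: "E \<ge> 1" "2 * (T * E) \<le> card A" "2 * n < E * card A" "E * E * (T * E + 2) < n"
    and n: "n \<le> K * (card A - T * E)" "n \<le> 2 ^ Lam" "20000 * (K + Lam) ^ 4 \<le> n div E"
    and T: "3000 * (K + Lam) ^ 2 \<le> T" and pos: "K > 0" "Lam > 0"
    and lo: "1200 * (K + Lam) * n + E * n \<le> m"
    and hi: "2 * (m + 1200 * (K + Lam) * n) \<le> (card A - T * E) ^ 2"
    and big: "n div snd_nd m + snd_nd m \<le> card A + 1"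
  shows "m \<in> subset_sums A"
proof -
  define M where "M e = {a\<in>A. e dvd a}" for e
  define D where "D = snd_nd m"
  note Dp = snd_nd_props[OF m, folded D_def]
  have finA: "finite A" using A finite_subset by blast
  have finM: "finite (M e)" for e using finA by (simp add: M_def)
  have cM: "card A = card (A - M e) + card (M e)" for e
    using card_Diff_subset[OF finM, of e A] card_mono[OF finA, of "M e"] by (auto simp: M_def)
  \<comment> \<open>The allowance is linear in \<open>e\<close> so that losing another
    \<open>T\<close> elements in passing to \<open>e * q >= 2 * e\<close> stays within
    \<open>T * (e * q - 1)\<close>. Maximality of \<open>e\<close> then yields
    \<open>robust\<close>.\<close>
  define G where "G = {e\<in>{1..E}. card (A - M e) \<le> T * (e - 1)}"
  have "1 \<in> G" using E(1) by (simp add: G_def M_def)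
  have finG: "finite G" by (simp add: G_def)
  define e where "e = Max G"
  have eG: "e \<in> G" unfolding e_def using \<open>1 \<in> G\<close> finG by (intro Max_in) auto
  have emax: "f \<le> e" if "f \<in> G" for f using finG that by (simp add: e_def)
  have e: "1 \<le> e" "e \<le> E" "card (A - M e) \<le> T * (e - 1)" using eG by (auto simp: G_def)
  have TE: "card (A - M e) \<le> T * E"
    using e by (meson diff_le_self le_trans mult_le_mono2)
  have cMe: "card A - T * E \<le> card (M e)" using cM[of e] TE by linarith
  have robust: "T \<le> card {a\<in>M e. \<not> e * q dvd a}" if q: "prime q" for q
  proof (rule ccontr)
    assume "\<not> ?thesis"
    then have less: "card {a\<in>M e. \<not> e * q dvd a} \<le> T" by simp
    have q2: "2 \<le> q" using q by (rule prime_ge_2_nat)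
    have "A - M (e * q) \<subseteq> (A - M e) \<union> {a\<in>M e. \<not> e * q dvd a}" by (auto simp: M_def)
    then have "card (A - M (e * q)) \<le> card ((A - M e) \<union> {a\<in>M e. \<not> e * q dvd a})"
      using finA finM by (intro card_mono) auto
    also have "\<dots> \<le> T * (e - 1) + T" using card_Un_le[of "A - M e" "{a\<in>M e. \<not> e * q dvd a}"] less e(3) by linarith
    also have "\<dots> = T * e" using e(1) by (cases e) auto
    finally have c: "card (A - M (e * q)) \<le> T * e" .
    have eq: "2 * e \<le> e * q" using q2 by simp
    show False
    proof (cases "e * q \<le> E")
      case True
      have "e \<le> e * q - 1" using eq e(1) by linarith
      then have "T * e \<le> T * (e * q - 1)" by (rule mult_le_mono2)
      then have "card (A - M (e * q)) \<le> T * (e * q - 1)" using c by linarith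
      moreover have "1 \<le> e * q" using eq e(1) by linarith
      ultimately have "e * q \<in> G" using True unfolding G_def by simp
      then have "e * q \<le> e" by (rule emax)
      then show False using eq e(1) by linarith
    next
      case False
      \<comment> \<open>Beyond \<open>E\<close> multiples are too sparse: at most
        \<open>n / E\<close> of them, less than half of \<open>A\<close>, while at most
        \<open>T * E\<close> elements, again at most half, are exceptional.\<close>
      have "card (M (e * q)) \<le> n div (e * q)" unfolding M_def by (rule card_multiples_le[OF A]) (use e eq in auto)
      then have "E * card (M (e * q)) \<le> (e * q) * (n div (e * q))" using False by (intro mult_le_mono) auto
      also have "\<dots> \<le> n" by (rule times_div_less_eq_dividend)
      finally have 1: "E * card (M (e * q)) \<le> n" .
      have "card A \<le> T * E + card (M (e * q))"
        using c cM[of "e * q"] mult_le_mono2[OF e(2), of T] by linarith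
      then have "E * card A \<le> E * (T * E) + E * card (M (e * q))"
        by (metis add_mult_distrib2 mult_le_mono2)
      moreover have "2 * (E * (T * E)) \<le> E * card A" using mult_le_mono2[OF E(2), of E] by (simp add: mult_ac)
      ultimately show False using 1 E(3) by linarith
    qed
  qed
  have mid: "y \<in> subset_sums (M e)" if y: "e dvd y" "1200 * (K + Lam) * n \<le> y" "y \<le> m" for y
    unfolding M_def
  proof (rule scaled_subset_sums_middle[OF A _ _ _ n(2) _ T pos y(1,2)])
    show "0 < e" using e by simp
    show "T \<le> card {a \<in> {a \<in> A. e dvd a}. \<not> e * q dvd a}" if "prime q" for q
      using robust[OF that] by (simp add: M_def)
    show "n \<le> K * card {a \<in> A. e dvd a}"
      using order_trans[OF n(1) mult_le_mono2[OF cMe, of K]] by (simp only: M_def)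
    have "n div E \<le> n div e" using e by (intro div_le_mono2) auto
    then show "20000 * (K + Lam) ^ 4 \<le> n div e" using n(3) by linarith
    have "2 * (y + 1200 * (K + Lam) * n) \<le> 2 * (m + 1200 * (K + Lam) * n)" using y(3) by simp
    also have "\<dots> \<le> (card A - T * E) ^ 2" by (rule hi)
    also have "\<dots> \<le> card (M e) ^ 2" using cMe by (intro power_mono) auto
    finally show "2 * (y + 1200 * (K + Lam) * n) \<le> card {a \<in> A. e dvd a} ^ 2" by (simp only: M_def)
  qed
  show ?thesis
  proof (cases "e dvd m")
    case True
    then have "m \<in> subset_sums (M e)" using mid lo by simp
    moreover have "M e \<subseteq> A" by (auto simp: M_def)
    ultimately show ?thesis using subset_sums_mono by blast
  next
    case False
    then have De: "D \<le> e" using Dp(3)[of e] e(1) by (meson not_le less_le_trans zero_less_one)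
    have Me: "card (M e) \<le> n div e" unfolding M_def by (rule card_multiples_le[OF A]) (use e in auto)
    \<comment> \<open>A larger \<open>e\<close> would leave at most \<open>n div (D + 1)\<close>
      multiples and \<open>T * E\<close> exceptions. By \<open>E(4)\<close> this is too little to
      compensate for the gap between \<open>n / D\<close> and \<open>n / (D + 1)\<close>.\<close>
    have "e = D"
    proof (rule ccontr)
      assume "e \<noteq> D"
      then have "D + 1 \<le> e" using De by simp
      then have "n div e \<le> n div (D + 1)" by (intro div_le_mono2) auto
      then have "n div D + 1 \<le> T * E + n div (D + 1)"
        using Me TE cM[of e] big Dp(2) by (simp add: D_def)
      then have "D * (D + 1) * (n div D + 1) \<le> D * (D + 1) * (T * E + n div (D + 1))" by (rule mult_le_mono2)
      also have "\<dots> = D * (D + 1) * (T * E) + D * ((D + 1) * (n div (D + 1)))" by (simp add: algebra_simps)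
      also have "D * ((D + 1) * (n div (D + 1))) \<le> D * n" using times_div_less_eq_dividend by (rule mult_le_mono2)
      also have "D * (D + 1) * (T * E) \<le> E * E * (T * E)"
        using \<open>D + 1 \<le> e\<close> e(2) by (intro mult_le_mono) auto
      finally have 1: "D * (D + 1) * (n div D + 1) \<le> E * E * (T * E) + D * n" by simp
      have "n < D * (n div D + 1)" using dividend_less_div_times[of D n] Dp(2) by (simp add: algebra_simps)
      then have "(D + 1) * n \<le> (D + 1) * (D * (n div D + 1))" by (intro mult_le_mono2) simp
      then have "D * n + n \<le> D * (D + 1) * (n div D + 1)" by (simp add: algebra_simps)
      then have "n \<le> E * E * (T * E)" using 1 by linarith
      then show False using E(4) by (simp add: algebra_simps)
    qed
    \<comment> \<open>At most \<open>n div D\<close> elements are multiples of \<open>D\<close>, so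
      \<open>big\<close> leaves the \<open>D - 1\<close> others that
      \<open>subset_sum_hits_residue\<close> asks for.\<close>
    have "D \<le> card (A - M e) + 1" using big Me cM[of e] unfolding \<open>e = D\<close> D_def by linarith
    then have "D - 1 \<le> card (A - M e)" by simp
    then obtain R where R: "R \<subseteq> A - M e" "card R = D - 1" using obtain_subset_with_card_n by metis
    have finR: "finite R" using R(1) finA finite_subset by blast
    have "\<exists>W\<subseteq>R. \<Sum>W mod D = m mod D"
    proof (rule subset_sum_hits_residue[OF _ Dp(3) finR])
      show "\<not> D dvd a" if "a \<in> R" for a using that R(1) \<open>e = D\<close> by (auto simp: M_def)
    qed (use Dp(2) R(2) in auto)
    then obtain W where W: "W \<subseteq> R" "\<Sum>W mod D = m mod D" by blast
    have Wn: "W \<subseteq> {1..n}" using W R A by blast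
    have "\<Sum>W \<in> subset_sums W" by (auto simp: subset_sums_def)
    then have "\<Sum>W \<le> card W * n" using subset_sums_le_card_mult[OF _ Wn] by blast
    also have "card W \<le> card R" using W(1) finR by (simp add: card_mono)
    also have "card R \<le> E" using R(2) De e(2) by linarith
    finally have sW: "\<Sum>W \<le> E * n" by simp
    have le: "\<Sum>W \<le> m" using sW lo by linarith
    have "m - \<Sum>W \<in> subset_sums (M e)"
    proof (rule mid)
      show "e dvd m - \<Sum>W" unfolding \<open>e = D\<close> using W(2) le by (metis mod_eq_dvd_iff_nat)
    qed (use sW lo in auto)
    moreover have "\<Sum>W \<in> subset_sums W" by (auto simp: subset_sums_def)
    ultimately have "(m - \<Sum>W) + \<Sum>W \<in> subset_sums (M e \<union> W)"
      by (intro subset_sums_Un finM) (use W R finR finite_subset in blast)+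
    moreover have "M e \<union> W \<subseteq> A" using W R by (auto simp: M_def)
    ultimately show ?thesis using le subset_sums_mono by (metis le_add_diff_inverse2 subsetD)
  qed
qed

lemma subset_sums_hits_eventually:
  fixes \<eta> :: real
  assumes \<eta>: "\<eta> > 0"
  shows "\<forall>\<^sub>F n in sequentially. \<forall>m A. A \<subseteq> {1..n} \<longrightarrow> 0 < m \<longrightarrow> 10000 * real n * ln (real n) \<le> real m \<longrightarrow>
    real n / (3 * ln (real n)) \<le> real (card A) \<longrightarrow> n div snd_nd m + snd_nd m \<le> card A + 1 \<longrightarrow>
    (1 + \<eta>) * sqrt (2 * real m) \<le> real (card A) \<longrightarrow> m \<in> subset_sums A"
proof -
  define \<theta> where "\<theta> = 1 - 1 / (1 + \<eta>)\<^sup>2"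
  have "1 < (1 + \<eta>)\<^sup>2" using \<eta> by (intro one_less_power) auto
  then have "1 / (1 + \<eta>)\<^sup>2 < 1" by (subst divide_less_eq_1_pos) linarith+
  then have \<theta>: "\<theta> > 0" by (simp add: \<theta>_def)
  have "(\<lambda>n. 48 / (ln (real n))\<^sup>2 + 180000 * (ln (real n)) ^ 3 / real n) \<longlonglongrightarrow> 0"
    by real_asymp
  then have e0: "\<forall>\<^sub>F n in sequentially. 48 / (ln (real n))\<^sup>2 + 180000 * (ln (real n)) ^ 3 / real n < \<theta>"
    using \<theta> by (rule order_tendstoD)
  have e1: "\<forall>\<^sub>F n in sequentially. 2 * (real n / ln (real n) ^ 4 * (8 * ln (real n))) \<le> real n / (3 * ln (real n))"
    by real_asymp
  have e2: "\<forall>\<^sub>F n in sequentially. (8 * ln (real n)) * (8 * ln (real n)) * (real n / ln (real n) ^ 4 * (8 * ln (real n)) + 2) < real n"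
    by real_asymp
  have e3: "\<forall>\<^sub>F n in sequentially. real n \<le> (4 * ln (real n)) * (real n / (3 * ln (real n)) - real n / ln (real n) ^ 4 * (8 * ln (real n)))"
    by real_asymp
  have e4: "\<forall>\<^sub>F n in sequentially. 20000 * (8 * ln (real n)) ^ 4 \<le> real n / (8 * ln (real n)) - 1"
    by real_asymp
  have e5: "\<forall>\<^sub>F n in sequentially. 3000 * (8 * ln (real n)) ^ 2 \<le> real n / ln (real n) ^ 4 - 1"
    by real_asymp
  have e6: "\<forall>\<^sub>F n in sequentially. 10 \<le> ln (real n)"
    by real_asymp
  show ?thesis
    using e0 e1 e2 e3 e4 e5 e6
  proof eventually_elim
    case (elim n)
    define l where "l = ln (real n)"
    note el = elim[folded l_def]
    have l: "10 \<le> l" using el(7) .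
    have n0: "n > 0" using l by (cases n) (auto simp: l_def)
    \<comment> \<open>\<open>E\<close> must exceed \<open>2 * n / card A\<close>, which is at most
      \<open>6 * l\<close>; \<open>K\<close> must slightly exceed \<open>3 * l\<close>, and
      \<open>Lam\<close> must be at least \<open>l / ln 2\<close>. \<open>T\<close> is far above
      \<open>(K + Lam) ^ 2\<close>, yet \<open>T * E ^ 3\<close> is only of order
      \<open>n / l\<close>.\<close>
    define E where "E = nat \<lceil>7 * l\<rceil>"
    define K where "K = nat \<lceil>4 * l\<rceil>"
    define Lam where "Lam = nat \<lceil>2 * l\<rceil>"
    define T where "T = nat \<lfloor>real n / l ^ 4\<rfloor>"
    have E: "7 * l \<le> real E" "real E \<le> 8 * l" using l unfolding E_def by linarith+
    have K: "4 * l \<le> real K" "real K \<le> 5 * l" using l unfolding K_def by linarith+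
    have L: "2 * l \<le> real Lam" "real Lam \<le> 3 * l" using l unfolding Lam_def by linarith+
    have Q: "real (K + Lam) \<le> 8 * l" using K L by simp
    have t0: "0 \<le> real n / l ^ 4" using l by simp
    have T: "real T \<le> real n / l ^ 4" "real n / l ^ 4 - 1 \<le> real T"
      using t0 unfolding T_def by linarith+
    have TE: "real (T * E) \<le> real n / l ^ 4 * (8 * l)"
      unfolding of_nat_mult using T(1) E(2) t0 by (intro mult_mono) auto
    show ?case
    proof (intro allI impI)
      fix m A
      assume A: "A \<subseteq> {1..n}" "0 < m" "10000 * real n * ln (real n) \<le> real m"
        "real n / (3 * ln (real n)) \<le> real (card A)" "n div snd_nd m + snd_nd m \<le> card A + 1"
        "(1 + \<eta>) * sqrt (2 * real m) \<le> real (card A)"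
      define a where "a = real (card A)"
      have a: "real n / (3 * l) \<le> a" using A(4) by (simp add: a_def l_def)
      have apos: "a > 0" using a n0 l by (smt (verit) divide_pos_pos of_nat_0_less_iff)
      have TEle: "2 * (T * E) \<le> card A"
      proof -
        have "real (2 * (T * E)) \<le> real (card A)" using TE el(2) a unfolding a_def by simp
        then show ?thesis by linarith
      qed
      have dif: "real (card A - T * E) = a - real (T * E)" using TEle by (simp add: a_def of_nat_diff)
      show "m \<in> subset_sums A"
      proof (rule subset_sums_hits[OF A(1,2), of E T K Lam])
        show "1 \<le> E" using E(1) l by linarith
        show "2 * (T * E) \<le> card A" by (rule TEle)
        have "real n * 7 / 3 = (7 * l) * (real n / (3 * l))" using l by simp
        also have "\<dots> \<le> real E * a" using E(1) a l n0 by (intro mult_mono) auto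
        finally have "real (2 * n) < real (E * card A)" using n0 by (simp add: a_def)
        then show "2 * n < E * card A" by linarith
        have "real (E * E * (T * E + 2)) = real E * real E * (real (T * E) + 2)"
          by (simp add: algebra_simps)
        also have "\<dots> \<le> (8 * l) * (8 * l) * (real n / l ^ 4 * (8 * l) + 2)"
          using E(2) TE l by (intro mult_mono) auto
        finally have "real (E * E * (T * E + 2)) \<le> (8 * l) * (8 * l) * (real n / l ^ 4 * (8 * l) + 2)" .
        then have "real (E * E * (T * E + 2)) < real n" using el(3) by linarith
        then show "E * E * (T * E + 2) < n" by linarith
        have "real n \<le> (4 * l) * (real n / (3 * l) - real n / l ^ 4 * (8 * l))" using el(4) .
        also have "\<dots> \<le> (4 * l) * (a - real (T * E))" using a TE l by (intro mult_left_mono) auto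
        also have "\<dots> \<le> real K * (a - real (T * E))"
          by (rule mult_right_mono[OF K(1)]) (use of_nat_0_le_iff[of "card A - T * E"] dif in linarith)
        also have "\<dots> = real (K * (card A - T * E))" using dif by simp
        finally show "n \<le> K * (card A - T * E)" by linarith
        have "real n = exp l" using n0 by (simp add: l_def)
        also have "\<dots> \<le> exp (ln 2 * real Lam)"
        proof -
          have "1 / 2 \<le> ln (2::real)" using ln_le_minus_one[of "1/2"] by (simp add: ln_div)
          then have "1 / 2 * (2 * l) \<le> ln 2 * real Lam" using L(1) l by (intro mult_mono) auto
          then show ?thesis by simp
        qed
        also have "\<dots> = 2 ^ Lam" by (simp add: exp_of_nat2_mult)
        finally have "real n \<le> real (2 ^ Lam)" by simp
        then show "n \<le> 2 ^ Lam" by linarith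
        have "real (20000 * (K + Lam) ^ 4) = 20000 * real (K + Lam) ^ 4" by simp
        also have "\<dots> \<le> 20000 * (8 * l) ^ 4"
          by (intro mult_left_mono power_mono Q) auto
        also have "\<dots> \<le> real n / (8 * l) - 1" using el(5) .
        also have "real n / (8 * l) \<le> real n / real E" using E l by (intro divide_left_mono) auto
        finally have "real (20000 * (K + Lam) ^ 4) \<le> real n / real E - 1" by simp
        also have "\<dots> \<le> real (n div E)"
        proof -
          have "real (n div E) = of_int \<lfloor>real n / real E\<rfloor>" by (simp add: floor_divide_of_nat_eq)
          then show ?thesis by linarith
        qed
        finally show "20000 * (K + Lam) ^ 4 \<le> n div E" by linarith
        have "real (3000 * (K + Lam) ^ 2) = 3000 * real (K + Lam) ^ 2" by simp
        also have "\<dots> \<le> 3000 * (8 * l) ^ 2"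
          by (intro mult_left_mono power_mono Q) auto
        also have "\<dots> \<le> real T" using el(6) T(2) by linarith
        finally show "3000 * (K + Lam) ^ 2 \<le> T" by linarith
        show "K > 0" "Lam > 0" using K L l by linarith+
        have Qn: "real (1200 * (K + Lam) * n) \<le> 9600 * l * real n"
          using mult_right_mono[OF Q, of "1200 * real n"] by (simp add: algebra_simps)
        have "real (1200 * (K + Lam) * n + E * n) \<le> 9600 * l * real n + 8 * l * real n"
          using Qn mult_right_mono[OF E(2), of "real n"] by simp
        also have "\<dots> \<le> 10000 * real n * l" using l by (simp add: algebra_simps)
        also have "\<dots> \<le> real m" using A(3) by (simp add: l_def)
        finally show "1200 * (K + Lam) * n + E * n \<le> m" by linarith
        have "((1 + \<eta>) * sqrt (2 * real m))\<^sup>2 \<le> a\<^sup>2"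
          using A(6) \<eta> unfolding a_def by (intro power_mono) auto
        then have "(1 + \<eta>)\<^sup>2 * (2 * real m) \<le> a\<^sup>2" by (simp add: power_mult_distrib)
        then have m2: "2 * real m \<le> a\<^sup>2 * (1 - \<theta>)" using \<eta> by (simp add: \<theta>_def field_simps)
        have n3: "real n \<le> 3 * l * a" using a l by (simp add: field_simps)
        have te: "real (T * E) \<le> 24 / l\<^sup>2 * a"
        proof -
          have "real (T * E) \<le> real n * (8 / l ^ 3)" using TE l by (simp add: field_simps power4_eq_xxxx power3_eq_cube)
          also have "\<dots> \<le> (3 * l * a) * (8 / l ^ 3)" using n3 l by (intro mult_right_mono) auto
          also have "\<dots> = 24 / l\<^sup>2 * a" using l by (simp add: field_simps power2_eq_square power3_eq_cube)
          finally show ?thesis .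
        qed
        have q2: "2 * (9600 * l * real n) \<le> a\<^sup>2 * (180000 * l ^ 3 / real n)"
        proof -
          have "real n * real n \<le> (3 * l * a) * (3 * l * a)" using n3 by (intro mult_mono) (use l apos in auto)
          then have "19200 * l * (real n * real n) \<le> 19200 * l * ((3 * l * a) * (3 * l * a))"
            using l by (intro mult_left_mono) auto
          also have "\<dots> = 172800 * (l ^ 3 * a\<^sup>2)" by (simp add: power2_eq_square power3_eq_cube)
          also have "\<dots> \<le> 180000 * (l ^ 3 * a\<^sup>2)" using l by (intro mult_right_mono) auto
          finally show ?thesis using n0 by (simp add: field_simps)
        qed
        have "real (2 * (m + 1200 * (K + Lam) * n)) \<le> a\<^sup>2 * (1 - \<theta>) + a\<^sup>2 * (180000 * l ^ 3 / real n)"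
          using m2 q2 Qn by simp
        also have "\<dots> = a\<^sup>2 * (1 - \<theta> + 180000 * l ^ 3 / real n)" by (simp add: algebra_simps)
        also have "\<dots> \<le> a\<^sup>2 * (1 - 48 / l\<^sup>2)" using el(1) by (intro mult_left_mono) auto
        also have "\<dots> \<le> (a - 24 / l\<^sup>2 * a)\<^sup>2"
        proof -
          have "a\<^sup>2 * (1 - 48 / l\<^sup>2) \<le> a\<^sup>2 * (1 - 24 / l\<^sup>2)\<^sup>2"
            by (intro mult_left_mono) (simp_all add: power2_diff)
          also have "\<dots> = (a - 24 / l\<^sup>2 * a)\<^sup>2" by (simp add: power_mult_distrib[symmetric] algebra_simps)
          finally show ?thesis .
        qed
        also have "\<dots> \<le> (a - real (T * E))\<^sup>2"
        proof (rule power_mono)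
          have "24 / l\<^sup>2 \<le> 1"
          proof -
            have "10 * 10 \<le> l * l" using l by (intro mult_mono) auto
            then show ?thesis using l by (simp add: field_simps power2_eq_square)
          qed
          then have "24 / l\<^sup>2 * a \<le> 1 * a" by (rule mult_right_mono) (use apos in simp)
          then show "0 \<le> a - 24 / l\<^sup>2 * a" by linarith
        qed (use te in simp)
        also have "\<dots> = real ((card A - T * E) ^ 2)" using dif by simp
        finally show "2 * (m + 1200 * (K + Lam) * n) \<le> (card A - T * E) ^ 2" by linarith
        show "n div snd_nd m + snd_nd m \<le> card A + 1" by (rule A(5))
      qed
    qed
  qed
qed

section \<open>Lower bounds\<close>

lemma g_fun_set_finite:
  "finite {card A | A. A \<subseteq> {1..n} \<and> (\<forall>B. B \<subseteq> A \<longrightarrow> \<Sum>B \<noteq> m)}" for n m :: nat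
  by (rule finite_subset[of _ "card ` Pow {1..n}"]) auto

lemma g_fun_ge:
  assumes "A \<subseteq> {1..n}" "m \<notin> subset_sums A"
  shows "card A \<le> g_fun n m"
  unfolding g_fun_def
  by (rule Max_ge[OF g_fun_set_finite]) (use assms in \<open>auto simp: subset_sums_def\<close>)

lemma g_fun_attained:
  assumes "m > 0"
  shows "\<exists>A\<subseteq>{1..n}. m \<notin> subset_sums A \<and> card A = g_fun n m"
proof -
  have "g_fun n m \<in> {card A | A. A \<subseteq> {1..n} \<and> (\<forall>B. B \<subseteq> A \<longrightarrow> \<Sum>B \<noteq> m)}"
    unfolding g_fun_def
    by (rule Max_in[OF g_fun_set_finite]) (use assms in \<open>auto intro!: exI[of _ "{}"]\<close>)
  then obtain A where "A \<subseteq> {1..n}" "\<forall>B. B \<subseteq> A \<longrightarrow> \<Sum>B \<noteq> m" "g_fun n m = card A" by blast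
  then show ?thesis by (intro exI[of _ A]) (auto simp: subset_sums_def)
qed

lemma double_sum_initial: "2 * \<Sum>{1..k} = k * (k + 1)" for k :: nat
  by (induction k) auto

lemma g_fun_ge_initial:
  assumes "k \<le> n" "k * (k + 1) < 2 * m"
  shows "k \<le> g_fun n m"
proof -
  have "m \<notin> subset_sums {1..k}"
  proof
    assume "m \<in> subset_sums {1..k}"
    then obtain W where W: "W \<subseteq> {1..k}" "m = \<Sum>W" by (auto simp: subset_sums_def)
    have "\<Sum>W \<le> \<Sum>{1..k}" by (rule sum_mono2) (use W in auto)
    then have "2 * m \<le> 2 * \<Sum>{1..k}" using W(2) by simp
    then show False using assms(2) unfolding double_sum_initial by simp
  qed
  then have "card {1..k} \<le> g_fun n m" by (intro g_fun_ge) (use assms in auto)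
  then show ?thesis by simp
qed

text \<open>A sum with \<open>p\<close> terms from \<open>P\<close> and \<open>q\<close> from
  \<open>Q\<close> is congruent to \<open>p - q\<close>, and \<open>r - p + q\<close> lies strictly
  between \<open>0\<close> and \<open>D\<close>, so the sum is not \<open>m\<close>. The conditions
  \<open>hP\<close> and \<open>hQ\<close> place the largest elements \<open>1 + (r - 2) * D\<close>
  and \<open>(D - r - 1) * D - 1\<close> below or at \<open>n\<close>.\<close>

lemma g_fun_ge_multiples:
  fixes n m :: nat
  defines "D \<equiv> snd_nd m"
  defines "r \<equiv> m mod D"
  assumes m: "m > 0" and hP: "r \<ge> 2 \<Longrightarrow> 1 + (r - 2) * D \<le> n" and hQ: "(D - r - 1) * D \<le> n + 1"
  shows "n div D + D - 2 \<le> g_fun n m"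
proof -
  note Dp = snd_nd_props[OF m, folded D_def]
  have r: "0 < r" "r < D" using Dp(1,2) by (auto simp: r_def mod_greater_zero_iff_not_dvd)
  define M where "M = (\<lambda>j. (j + 1) * D) ` {..<n div D}"
  define P where "P = (\<lambda>j. 1 + j * D) ` {..<r - 1}"
  define Q where "Q = (\<lambda>j. (j + 1) * D - 1) ` {..<D - r - 1}"
  have D0: "D > 0" using Dp(2) by simp
  have cM: "card M = n div D" unfolding M_def using D0 by (subst card_image) (auto simp: inj_on_def)
  have cP: "card P = r - 1" unfolding P_def using D0 by (subst card_image) (auto simp: inj_on_def)
  have "inj_on (\<lambda>j. (j + 1) * D - 1) {..<D - r - 1}"
  proof (rule inj_onI)
    fix i j assume "(i + 1) * D - 1 = (j + 1) * D - 1"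
    moreover have "(i + 1) * D \<ge> 1" "(j + 1) * D \<ge> 1" using D0 by auto
    ultimately have "(i + 1) * D = (j + 1) * D" by linarith
    then show "i = j" using D0 by simp
  qed
  then have cQ: "card Q = D - r - 1" unfolding Q_def by (simp add: card_image)
  have fin: "finite M" "finite P" "finite Q" by (auto simp: M_def P_def Q_def)
  have mM: "a mod D = 0" if "a \<in> M" for a using that by (auto simp: M_def)
  have mP: "a mod D = 1" "r \<ge> 2" if aP: "a \<in> P" for a
  proof -
    obtain j where j: "j < r - 1" "a = 1 + j * D" using aP by (auto simp: P_def)
    then show "r \<ge> 2" by linarith
    then have "1 < D" using r by linarith
    then show "a mod D = 1" unfolding j(2) by (simp only: mod_mult_self1 mod_less)
  qed
  have mQ: "(a + 1) mod D = 0" "r + 2 \<le> D" if aQ: "a \<in> Q" for a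
  proof -
    obtain j where j: "j < D - r - 1" "a = (j + 1) * D - 1" using aQ by (auto simp: Q_def)
    have "1 \<le> (j + 1) * D" using D0 by simp
    then have "a + 1 = (j + 1) * D" using j(2) by linarith
    then show "(a + 1) mod D = 0" by simp
    show "r + 2 \<le> D" using j(1) by linarith
  qed
  have mQ': "a mod D = D - 1" if "a \<in> Q" for a
    using mQ(1)[OF that] D0 by (metis diff_Suc_1 mod_Suc nat.distinct(1) Suc_eq_plus1)
  have d1: "M \<inter> P = {}" using mM mP by force
  have d2: "M \<inter> Q = {}"
  proof -
    have "D - 1 \<noteq> 0" using Dp(2) by simp
    then show ?thesis using mM mQ' by fastforce
  qed
  \<comment> \<open>The residues \<open>1\<close> and \<open>-1\<close> agree only for
    \<open>D = 2\<close>, and then \<open>P\<close> is empty.\<close>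
  have d3: "P \<inter> Q = {}"
  proof (rule ccontr)
    assume "P \<inter> Q \<noteq> {}"
    then obtain a where a: "a \<in> P" "a \<in> Q" by blast
    have "D - 1 = 1" using mP(1)[OF a(1)] mQ'[OF a(2)] by simp
    then show False using mP(2)[OF a(1)] r by simp
  qed
  define A where "A = M \<union> P \<union> Q"
  have cA: "card A = n div D + (r - 1) + (D - r - 1)"
    unfolding A_def using card_Un_disjoint[of "M \<union> P" Q] card_Un_disjoint[of M P] fin d1 d2 d3 cM cP cQ
    by (simp add: Int_Un_distrib2)
  have "A \<subseteq> {1..n}"
  proof -
    have "a \<in> {1..n}" if aM: "a \<in> M" for a
    proof -
      obtain j where j: "j < n div D" "a = (j + 1) * D" using aM by (auto simp: M_def)
      have "(j + 1) * D \<le> n div D * D" using j(1) by (intro mult_le_mono) auto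
      also have "\<dots> \<le> n" by (rule div_times_less_eq_dividend)
      finally show ?thesis using j(2) D0 by auto
    qed
    moreover have "a \<in> {1..n}" if aP: "a \<in> P" for a
    proof -
      obtain j where j: "j < r - 1" "a = 1 + j * D" using aP by (auto simp: P_def)
      have "j * D \<le> (r - 2) * D" using j(1) by (intro mult_le_mono) auto
      moreover have "2 \<le> r" using j(1) by linarith
      ultimately have "1 + j * D \<le> n" using hP by linarith
      then show ?thesis using j(2) by simp
    qed
    moreover have "a \<in> {1..n}" if aQ: "a \<in> Q" for a
    proof -
      obtain j where j: "j < D - r - 1" "a = (j + 1) * D - 1" using aQ by (auto simp: Q_def)
      have "(j + 1) * D \<le> (D - r - 1) * D" using j(1) by (intro mult_le_mono) auto
      then have "a \<le> n" using hQ j by linarith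
      moreover have "1 * 2 \<le> (j + 1) * D" using Dp(2) by (intro mult_le_mono) auto
      ultimately show ?thesis using j(2) by auto
    qed
    ultimately show ?thesis by (auto simp: A_def)
  qed
  moreover have "m \<notin> subset_sums A"
  proof
    assume "m \<in> subset_sums A"
    then obtain W where W: "W \<subseteq> A" "m = \<Sum>W" by (auto simp: subset_sums_def)
    define p where "p = int (card (W \<inter> P))"
    define q where "q = int (card (W \<inter> Q))"
    have pq: "0 \<le> p" "p \<le> int (r - 1)" "0 \<le> q" "q \<le> int (D - r - 1)"
      using card_mono[OF fin(2), of "W \<inter> P"] card_mono[OF fin(3), of "W \<inter> Q"] cP cQ
      by (auto simp: p_def q_def)
    have WU: "W = (W \<inter> M) \<union> (W \<inter> P) \<union> (W \<inter> Q)" using W(1) by (auto simp: A_def)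
    have "\<Sum>W = \<Sum>((W \<inter> M) \<union> (W \<inter> P) \<union> (W \<inter> Q))" using WU by simp
    also have "\<dots> = \<Sum>(W \<inter> M) + \<Sum>(W \<inter> P) + \<Sum>(W \<inter> Q)"
    proof -
      have "((W \<inter> M) \<union> (W \<inter> P)) \<inter> (W \<inter> Q) = {}" "(W \<inter> M) \<inter> (W \<inter> P) = {}" using d1 d2 d3 by auto
      then show ?thesis using fin by (simp add: sum.union_disjoint)
    qed
    finally have sum: "int m = int (\<Sum>(W \<inter> M)) + int (\<Sum>(W \<inter> P)) + int (\<Sum>(W \<inter> Q))" using W(2) by simp
    have 1: "int D dvd int (\<Sum>(W \<inter> M))"
      unfolding int_dvd_int_iff by (rule dvd_sum) (use mM in \<open>auto simp: dvd_eq_mod_eq_0\<close>)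
    have 2: "int D dvd int (\<Sum>(W \<inter> P)) - p"
    proof -
      have "int (\<Sum>(W \<inter> P)) - p = (\<Sum>a\<in>W \<inter> P. int a - 1)"
        by (simp add: p_def sum_subtractf)
      also have "int D dvd \<dots>"
      proof (rule dvd_sum)
        fix a assume "a \<in> W \<inter> P"
        then obtain j where "a = 1 + j * D" by (auto simp: P_def)
        then show "int D dvd int a - 1" by simp
      qed
      finally show ?thesis .
    qed
    have 3: "int D dvd int (\<Sum>(W \<inter> Q)) + q"
    proof -
      have "int (\<Sum>(W \<inter> Q)) + q = (\<Sum>a\<in>W \<inter> Q. int a + 1)"
        by (simp add: q_def sum.distrib)
      also have "int D dvd \<dots>"
      proof (rule dvd_sum)
        fix a assume "a \<in> W \<inter> Q"
        then have "D dvd a + 1" using mQ(1) by (simp add: dvd_eq_mod_eq_0)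
        then have "int D dvd int (a + 1)" by (simp only: int_dvd_int_iff)
        then show "int D dvd int a + 1" by (simp add: add.commute)
      qed
      finally show ?thesis .
    qed
    have 4: "int D dvd int m - int r"
    proof -
      have "r \<le> m" "m mod D = r mod D" by (simp_all add: r_def)
      then have "D dvd m - r" by (metis mod_eq_dvd_iff_nat)
      then have "int D dvd int (m - r)" by (simp only: int_dvd_int_iff)
      then show ?thesis using \<open>r \<le> m\<close> by (simp add: of_nat_diff)
    qed
    have "int D dvd int (\<Sum>(W \<inter> M)) + (int (\<Sum>(W \<inter> P)) - p) + (int (\<Sum>(W \<inter> Q)) + q) - (int m - int r)"
      by (rule dvd_diff[OF dvd_add[OF dvd_add[OF 1 2] 3] 4])
    then have "int D dvd int r - p + q" using sum by (simp add: algebra_simps)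
    moreover have "0 < int r - p + q" "int r - p + q < int D" using pq r by auto
    ultimately show False using zdvd_not_zless by blast
  qed
  ultimately have "card A \<le> g_fun n m" by (rule g_fun_ge)
  then show ?thesis using cA r by linarith
qed

text \<open>The middle factor is coprime to its neighbours, and the greatest common divisor of the
  outer two divides \<open>2\<close>.\<close>

lemma prod_three_consecutive_dvd:
  fixes a m :: nat
  assumes "a dvd m" "a + 1 dvd m" "a + 2 dvd m"
  shows "a * (a + 1) * (a + 2) dvd 2 * m"
proof -
  have "coprime a (a + 1)" "coprime (a + 1) (a + 2)"
    using coprime_Suc_right_nat[of a] coprime_Suc_right_nat[of "Suc a"] by simp_all
  obtain k where k: "m = (a + 1) * k" using assms(2) by blast
  have "a dvd k" using assms(1) \<open>coprime a (a + 1)\<close> unfolding k by (simp only: coprime_dvd_mult_right_iff)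
  moreover have "a + 2 dvd k" using assms(3) \<open>coprime (a + 1) (a + 2)\<close>
    unfolding k by (simp only: coprime_commute coprime_dvd_mult_right_iff)
  ultimately have "lcm a (a + 2) dvd k" by (rule lcm_least)
  moreover have "gcd a (a + 2) dvd 2"
  proof -
    have "gcd a (a + 2) dvd (a + 2) - a" by (rule dvd_diff_nat) auto
    then show ?thesis by simp
  qed
  ultimately have "lcm a (a + 2) * gcd a (a + 2) dvd k * 2" by (rule mult_dvd_mono)
  moreover have "lcm a (a + 2) * gcd a (a + 2) = a * (a + 2)"
    using prod_gcd_lcm_nat[of a "a + 2"] by (simp only: mult.commute)
  ultimately have "(a + 1) * (a * (a + 2)) dvd (a + 1) * (k * 2)" by (simp only: mult_dvd_mono dvd_refl)
  then show ?thesis unfolding k by (simp only: mult_ac)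
qed

text \<open>If \<open>(D - 2) * D <= n + 1\<close>, the construction from multiples fits into
  \<open>{1..n}\<close>. Otherwise, for \<open>D >= 6\<close>, divisibility by all smaller integers
  makes \<open>m\<close> of order at least \<open>D ^ 3\<close>, so an initial segment of the
  desired size has sum below \<open>m\<close>. Small \<open>D\<close> are treated
  separately.\<close>

lemma s_fun_le_g_fun:
  assumes m: "m > 0" "2 * m \<le> n * (n + 1)"
  shows "s_fun n m \<le> int (g_fun n m)"
proof -
  define D where "D = snd_nd m"
  define r where "r = m mod D"
  note Dp = snd_nd_props[OF m(1), folded D_def]
  have r: "0 < r" "r < D" using Dp(1,2) by (auto simp: r_def mod_greater_zero_iff_not_dvd)
  have mult: "n div D + D - 2 \<le> g_fun n m" if "r \<ge> 2 \<Longrightarrow> 1 + (r - 2) * D \<le> n" "(D - r - 1) * D \<le> n + 1"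
    using g_fun_ge_multiples[OF m(1), of n] that unfolding r_def D_def by blast
  have init: "n div D + D - 2 \<le> g_fun n m" if "n div D + D - 2 \<le> k" "k \<le> n" "k * (k + 1) < 2 * m" for k
    using g_fun_ge_initial[OF that(2,3)] that(1) by linarith
  have n_ge: "k < n" if "k * (k + 1) < 2 * m" for k
  proof (rule ccontr)
    assume "\<not> k < n"
    then have "n * (n + 1) \<le> k * (k + 1)" by (intro mult_le_mono) auto
    then show False using that m(2) by linarith
  qed
  have "n div D + D - 2 \<le> g_fun n m"
  proof (cases "(D - 2) * D \<le> n + 1")
    case True
    show ?thesis
    proof (rule mult)
      have "(D - r - 1) * D \<le> (D - 2) * D" using r by (intro mult_le_mono) auto
      then show "(D - r - 1) * D \<le> n + 1" using True by linarith
      assume "r \<ge> 2"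
      then have D3: "D \<ge> 3" using r by linarith
      have "(r - 2) * D \<le> (D - 3) * D" using r by (intro mult_le_mono) auto
      moreover have "(D - 3) * D + D = (D - 2) * D"
      proof -
        have "D - 2 = (D - 3) + 1" using D3 by simp
        then show ?thesis by (metis add_mult_distrib mult_1)
      qed
      ultimately show "1 + (r - 2) * D \<le> n" using True D3 by linarith
    qed
  next
    case False
    have "D \<noteq> 2" using False by auto
    moreover have "D \<noteq> 3"
    proof
      assume "D = 3"
      then have "2 dvd m" using Dp(3)[of 2] by simp
      then have "1 * (1 + 1) < 2 * m" using m(1) by (auto elim!: dvdE)
      then show False using n_ge[of 1] False \<open>D = 3\<close> by simp
    qed
    ultimately have "D = 4 \<or> D = 5 \<or> 6 \<le> D" using Dp(2) by linarith
    then show ?thesis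
    proof (elim disjE)
      assume D: "D = 4"
      then have "2 dvd m" "3 dvd m" using Dp(3) by auto
      have "r = 2" using r D \<open>2 dvd m\<close> unfolding r_def by presburger
      moreover have "6 \<le> m" using \<open>2 dvd m\<close> \<open>3 dvd m\<close> m(1) by presburger
      ultimately show ?thesis using n_ge[of 2] D by (intro mult) auto
    next
      \<comment> \<open>Here \<open>12\<close> divides \<open>m\<close>. For \<open>m = 12\<close>
        the construction needs \<open>n >= 9\<close>, and below that \<open>{1..4}\<close> suffices;
        for \<open>m >= 24\<close> the segment \<open>{1..5}\<close> suffices.\<close>
      assume D: "D = 5"
      then have "3 dvd m" "4 dvd m" using Dp(3) by auto
      then have "12 dvd m" by presburger
      then obtain c where c: "m = 12 * c" by blast
      have n13: "n \<le> 13" using False D by simp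
      have n5: "4 < n" using n_ge[of 4] c m(1) by simp
      show ?thesis
      proof (cases "c = 1")
        case True
        then have "r = 2" using c D by (simp add: r_def)
        show ?thesis
        proof (cases "9 \<le> n")
          case True
          then show ?thesis using \<open>r = 2\<close> D by (intro mult) auto
        next
          case False
          then have "n div 5 + 5 - 2 \<le> 4" by linarith
          then show ?thesis using D n5 c \<open>c = 1\<close> by (intro init[of 4]) auto
        qed
      next
        case False
        then have "2 \<le> c" using c m(1) by (cases c) auto
        then have "24 \<le> m" using c by simp
        moreover have "n div 5 + 5 - 2 \<le> 5" using n13 by linarith
        ultimately show ?thesis using D n5 by (intro init[of 5]) auto
      qed
    next
      assume D6: "6 \<le> D"
      \<comment> \<open>The integers \<open>D - 3\<close>, \<open>D - 2\<close>,
        \<open>D - 1\<close> divide \<open>m\<close>, so \<open>2 * m\<close> is at least their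
        product, which exceeds \<open>(2 * a + 1) * (2 * a + 2)\<close> once
        \<open>a >= 3\<close>.\<close>
      define a where "a = D - 3"
      have D: "D = a + 3" and a3: "3 \<le> a" using D6 by (auto simp: a_def)
      have "a * (a + 1) * (a + 2) dvd 2 * m"
        by (rule prod_three_consecutive_dvd) (use Dp(3) D a3 in auto)
      then have big: "a * (a + 1) * (a + 2) \<le> 2 * m" using m(1) by (intro dvd_imp_le) auto
      have nD: "n div D \<le> a"
      proof -
        have "n < (a + 1) * D" using False D by simp
        then have "n div D < a + 1" using D by (simp add: div_less_iff_less_mult)
        then show ?thesis by simp
      qed
      have s: "n div D + D - 2 \<le> 2 * a + 1" using nD D by simp
      have lt: "(n div D + D - 2) * (n div D + D - 2 + 1) < 2 * m"
      proof -
        have "(n div D + D - 2) * (n div D + D - 2 + 1) \<le> (2 * a + 1) * (2 * a + 2)"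
          using s by (intro mult_le_mono) auto
        also have "\<dots> = (a + 1) * (4 * a + 2)" by (simp add: algebra_simps)
        also have "\<dots> < (a + 1) * (a * (a + 2))"
        proof -
          have "3 * a \<le> a * a" using a3 by simp
          moreover have "a * (a + 2) = a * a + 2 * a" by simp
          ultimately have "4 * a + 2 < a * (a + 2)" using a3 by linarith
          then show ?thesis by (intro mult_strict_left_mono) auto
        qed
        also have "\<dots> = a * (a + 1) * (a + 2)" by (simp only: mult_ac)
        finally show ?thesis using big by linarith
      qed
      then show ?thesis using n_ge[OF lt] by (intro init[of "n div D + D - 2"]) auto
    qed
  qed
  then show ?thesis unfolding s_fun_def D_def[symmetric] using Dp(2) by linarith
qed

section \<open>A Chebyshev bound for the smallest non-divisor\<close>

lemma multiplicity_eq_card_powers: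
  fixes p x N :: nat
  assumes "prime p" "x > 0" "x \<le> N"
  shows "multiplicity p x = card {k\<in>{1..N}. p ^ k dvd x}"
proof -
  have p: "\<not> is_unit p" "x \<noteq> 0" using assms(1,2) by auto
  have iff: "p ^ k dvd x \<longleftrightarrow> k \<le> multiplicity p x" for k
    using power_dvd_iff_le_multiplicity[of x p k] p by auto
  have "p ^ multiplicity p x dvd x" using iff by blast
  then have "p ^ multiplicity p x \<le> N" using assms(2,3) dvd_imp_le le_trans by blast
  moreover have "multiplicity p x < p ^ multiplicity p x"
    using prime_gt_1_nat[OF assms(1)] by (intro power_gt_expt) simp
  ultimately have "multiplicity p x \<le> N" by linarith
  then have "{k\<in>{1..N}. p ^ k dvd x} = {1..multiplicity p x}" unfolding iff by auto
  then show ?thesis by simp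
qed

text \<open>Legendre's formula; the common cutoff \<open>N\<close> lets the formulas for several
  factorials be combined term by term.\<close>

lemma multiplicity_fact_eq_sum:
  fixes p n N :: nat
  assumes "prime p" "n \<le> N"
  shows "multiplicity p (fact n :: nat) = (\<Sum>k=1..N. n div p ^ k)"
  using assms(2)
proof (induction n)
  case 0 then show ?case by simp
next
  case (Suc n)
  have "multiplicity p (fact (Suc n) :: nat) = multiplicity p (Suc n) + multiplicity p (fact n :: nat)"
    using assms(1) by (simp add: prime_elem_multiplicity_mult_distrib del: of_nat_Suc mult_Suc)
  also have "multiplicity p (Suc n) = card {k\<in>{1..N}. p ^ k dvd Suc n}"
    by (rule multiplicity_eq_card_powers) (use assms(1) Suc.prems in auto)
  also have "\<dots> = (\<Sum>k=1..N. if p ^ k dvd Suc n then 1 else 0)"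
    by (simp add: sum.If_cases Int_def)
  also have "multiplicity p (fact n :: nat) = (\<Sum>k=1..N. n div p ^ k)" using Suc by simp
  finally have "multiplicity p (fact (Suc n) :: nat) =
      (\<Sum>k=1..N. (if p ^ k dvd Suc n then 1 else 0) + n div p ^ k)"
    by (simp only: sum.distrib)
  also have "\<dots> = (\<Sum>k=1..N. Suc n div p ^ k)"
    by (rule sum.cong) (auto simp: div_Suc dvd_eq_mod_eq_0)
  finally show ?case .
qed

text \<open>Chebyshev's method with the integral factorial ratio
  \<open>(12t)! t! / ((6t)! (4t)! (3t)!)\<close>: it divides every common multiple of \<open>1, \<dots>, 12t\<close> because
  \<open>\<lfloor>x\<rfloor> + \<lfloor>x/12\<rfloor> - \<lfloor>x/2\<rfloor> - \<lfloor>x/3\<rfloor> - \<lfloor>x/4\<rfloor>\<close> only takes the values \<open>0\<close> and \<open>1\<close>.\<close>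
lemma chebyshev_ratio_dvd:
  fixes m t :: nat
  assumes m: "m > 0" "\<And>k. 0 < k \<Longrightarrow> k \<le> 12 * t \<Longrightarrow> k dvd m"
  shows "fact (12 * t) * fact t dvd fact (6 * t) * fact (4 * t) * fact (3 * t) * m"
proof (rule multiplicity_le_imp_dvd)
  show "fact (12 * t) * fact t \<noteq> (0::nat)" by simp
  fix p :: nat assume p: "prime p"
  let ?N = "12 * t"
  have ge: "card {k\<in>{1..?N}. p ^ k \<le> ?N} \<le> multiplicity p m"
  proof -
    have "{k\<in>{1..?N}. p ^ k \<le> ?N} \<subseteq> {1..multiplicity p m}"
    proof
      fix k assume k: "k \<in> {k\<in>{1..?N}. p ^ k \<le> ?N}"
      then have "p ^ k dvd m" using m(2)[of "p ^ k"] prime_gt_0_nat[OF p] by simp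
      then have "k \<le> multiplicity p m" using m(1) p by (intro multiplicity_geI) auto
      then show "k \<in> {1..multiplicity p m}" using k by simp
    qed
    then have "card {k\<in>{1..?N}. p ^ k \<le> ?N} \<le> card {1..multiplicity p m}" by (intro card_mono) auto
    then show ?thesis by simp
  qed
  have pt: "12 * t div q + t div q \<le> 6 * t div q + 4 * t div q + 3 * t div q + (if q \<le> 12 * t then 1 else 0)"
    if "q > 0" for q :: nat
  proof -
    \<comment> \<open>All the other quotients are floors of \<open>X / b\<close> with
      \<open>b\<close> dividing \<open>12\<close>, so only the residue of \<open>X\<close> modulo
      \<open>12\<close> and whether \<open>X\<close> vanishes matter.\<close>
    define X where "X = 12 * t div q"
    have c: "c * t div q = X div b" if "c * b = 12" "b > 0" for b c
    proof -
      have "X div b = 12 * t div (q * b)" by (simp add: X_def div_mult2_eq)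
      also have "12 * t = (c * t) * b" using that(1) by (metis mult.commute mult.assoc)
      also have "(c * t) * b div (q * b) = c * t div q" using that(2) by simp
      finally show ?thesis by simp
    qed
    have "t div q = X div 12" "6 * t div q = X div 2" "4 * t div q = X div 3" "3 * t div q = X div 4"
      using c[of 1 12] c[of 6 2] c[of 4 3] c[of 3 4] by auto
    moreover have "X + X div 12 \<le> X div 2 + X div 3 + X div 4 + (if 0 < X then 1 else 0)"
    proof -
      define u where "u = X div 12"
      define x where "x = X mod 12"
      have X: "X = 12 * u + x" "x < 12" by (simp_all add: u_def x_def)
      have "X div 2 = 6 * u + x div 2" "X div 3 = 4 * u + x div 3" "X div 4 = 3 * u + x div 4"
        unfolding X(1) by simp_all
      moreover have "x \<le> x div 2 + x div 3 + x div 4 + (if 0 < x then 1 else 0)"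
      proof -
        have "x = 0 \<or> x = 1 \<or> x = 2 \<or> x = 3 \<or> x = 4 \<or> x = 5 \<or> x = 6 \<or> x = 7 \<or> x = 8 \<or> x = 9 \<or>
            x = 10 \<or> x = 11" using X(2) by presburger
        then show ?thesis by (elim disjE) simp_all
      qed
      ultimately show ?thesis using X(1) unfolding u_def[symmetric] by (auto split: if_splits)
    qed
    moreover have "0 < X \<longleftrightarrow> q \<le> 12 * t" unfolding X_def using \<open>q > 0\<close> by (simp add: div_greater_zero_iff)
    ultimately show ?thesis unfolding X_def[symmetric] by simp
  qed
  have "multiplicity p (fact (12 * t) * fact t :: nat) = multiplicity p (fact (12 * t) :: nat) + multiplicity p (fact t :: nat)"
    using p by (intro prime_elem_multiplicity_mult_distrib) auto
  also have "\<dots> = (\<Sum>k=1..?N. 12 * t div p ^ k + t div p ^ k)"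
    using multiplicity_fact_eq_sum[OF p, of "12 * t" ?N] multiplicity_fact_eq_sum[OF p, of t ?N]
    by (simp add: sum.distrib)
  also have "\<dots> \<le> (\<Sum>k=1..?N. 6 * t div p ^ k + 4 * t div p ^ k + 3 * t div p ^ k + (if p ^ k \<le> 12 * t then 1 else 0))"
    by (rule sum_mono, rule pt) (use prime_gt_0_nat[OF p] in simp)
  also have "\<dots> = multiplicity p (fact (6 * t) :: nat) + multiplicity p (fact (4 * t) :: nat)
      + multiplicity p (fact (3 * t) :: nat) + card {k\<in>{1..?N}. p ^ k \<le> ?N}"
    using multiplicity_fact_eq_sum[OF p, of "6 * t" ?N] multiplicity_fact_eq_sum[OF p, of "4 * t" ?N]
      multiplicity_fact_eq_sum[OF p, of "3 * t" ?N]
    by (simp add: sum.distrib sum.If_cases Int_def)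
  also have "\<dots> \<le> multiplicity p (fact (6 * t) :: nat) + multiplicity p (fact (4 * t) :: nat)
      + multiplicity p (fact (3 * t) :: nat) + multiplicity p m" using ge by simp
  also have "\<dots> = multiplicity p (fact (6 * t) * fact (4 * t) * fact (3 * t) * m)"
    using p m(1) by (simp add: prime_elem_multiplicity_mult_distrib)
  finally show "multiplicity p (fact (12 * t) * fact t :: nat)
      \<le> multiplicity p (fact (6 * t) * fact (4 * t) * fact (3 * t) * m)" .
qed

section \<open>Growth of the Chebyshev ratio\<close>

definition chebyshev_ratio :: "nat \<Rightarrow> real" where
  "chebyshev_ratio t = fact (12 * t) * fact t / (fact (6 * t) * fact (4 * t) * fact (3 * t))"

lemma chebyshev_ratio_pos: "chebyshev_ratio t > 0"
  by (simp add: chebyshev_ratio_def)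

lemma fact_add_eq_prod: "fact (a + k) = fact a * (\<Prod>i=1..k. real (a + i))"
  by (induction k) (auto simp: algebra_simps)

text \<open>Among the twelve new factors of the largest factorial, the even ones cancel against
  \<open>fact (6 * t)\<close> and the odd multiples of \<open>3\<close> against two factors of
  \<open>fact (4 * t)\<close>. The four coprime to \<open>12\<close> survive, and
  \<open>48 = 64 * 9 / (4 * 3)\<close>.\<close>

lemma chebyshev_ratio_Suc:
  "chebyshev_ratio (Suc t) * ((4 * real t + 2) * (3 * real t + 1) * (3 * real t + 2) * (real t + 1)) =
    chebyshev_ratio t * (48 * (12 * real t + 1) * (12 * real t + 5) * (12 * real t + 7) * (12 * real t + 11))"
proof -
  have e12: "fact (12 * Suc t) = fact (12 * t) * (\<Prod>i=1..12. real (12 * t + i))"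
    using fact_add_eq_prod[of "12 * t" 12] by (simp add: add.commute)
  have e6: "fact (6 * Suc t) = fact (6 * t) * (\<Prod>i=1..6. real (6 * t + i))"
    using fact_add_eq_prod[of "6 * t" 6] by (simp add: add.commute)
  have e4: "fact (4 * Suc t) = fact (4 * t) * (\<Prod>i=1..4. real (4 * t + i))"
    using fact_add_eq_prod[of "4 * t" 4] by (simp add: add.commute)
  have e3: "fact (3 * Suc t) = fact (3 * t) * (\<Prod>i=1..3. real (3 * t + i))"
    using fact_add_eq_prod[of "3 * t" 3] by (simp add: add.commute)
  have e1: "fact (Suc t) = fact t * (real t + 1)" by (simp add: algebra_simps)
  define x where "x = real t"
  have x: "x \<ge> 0" by (simp add: x_def)
  have id12: "{1..12} = {1,2,3,4,5,6,7,8,9,10,11,12::nat}" by (rule Set.set_eqI) (simp, presburger)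
  have id6: "{1..6} = {1,2,3,4,5,6::nat}" by (rule Set.set_eqI) (simp, presburger)
  have id4: "{1..4} = {1,2,3,4::nat}" by (rule Set.set_eqI) (simp, presburger)
  have id3: "{1..3} = {1,2,3::nat}" by (rule Set.set_eqI) (simp, presburger)
  have p12: "(\<Prod>i=1..12. real (12 * t + i)) =
      ((12*x+1)*(12*x+5)*(12*x+7)*(12*x+11)) * ((12*x+3)*(12*x+9))
      * ((12*x+2)*(12*x+4)*(12*x+6)*(12*x+8)*(12*x+10)*(12*x+12))"
    unfolding id12 by (simp add: x_def algebra_simps)
  have p6: "64 * (\<Prod>i=1..6. real (6 * t + i)) = (12*x+2)*(12*x+4)*(12*x+6)*(12*x+8)*(12*x+10)*(12*x+12)"
  proof -
    have "(\<Prod>i=1..6. real (6 * t + i)) = (6*x+1)*((6*x+2)*((6*x+3)*((6*x+4)*((6*x+5)*(6*x+6)))))"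
      unfolding id6 by (simp add: x_def)
    moreover have "12*x+2 = 2*(6*x+1)" "12*x+4 = 2*(6*x+2)" "12*x+6 = 2*(6*x+3)" "12*x+8 = 2*(6*x+4)"
      "12*x+10 = 2*(6*x+5)" "12*x+12 = 2*(6*x+6)" by simp_all
    ultimately show ?thesis by (simp only:)
  qed
  have p4: "9 * (\<Prod>i=1..4. real (4 * t + i)) = ((12*x+3)*(12*x+9)) * ((4*x+2)*(4*(x+1)))"
  proof -
    have eq: "(\<Prod>i=1..4. real (4 * t + i)) = (4*x+1)*((4*x+2)*((4*x+3)*(4*x+4)))"
      unfolding id4 by (simp add: x_def)
    show ?thesis unfolding eq by (simp add: algebra_simps)
  qed
  have p3: "(\<Prod>i=1..3. real (3 * t + i)) = (3*x+1)*(3*x+2)*(3*(x+1))"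
    unfolding id3 by (simp add: x_def algebra_simps)
  define U where "U = (12*x+2)*(12*x+4)*(12*x+6)*(12*x+8)*(12*x+10)*(12*x+12)"
  define V where "V = (12*x+3)*(12*x+9)"
  define Y where "Y = (12*x+1)*(12*x+5)*(12*x+7)*(12*x+11)"
  have UV: "U > 0" "V > 0" using x by (auto simp: U_def V_def)
  have f6: "(\<Prod>i=1..6. real (6 * t + i)) = U / 64" using p6 unfolding U_def by simp
  have f4: "(\<Prod>i=1..4. real (4 * t + i)) = V * ((4*x+2)*(4*(x+1))) / 9" using p4 unfolding V_def by simp
  have f12: "(\<Prod>i=1..12. real (12 * t + i)) = Y * V * U" using p12 unfolding U_def V_def Y_def by simp
  have "chebyshev_ratio (Suc t) = chebyshev_ratio t *
      ((Y * V * U * (x + 1)) / ((U / 64) * (V * ((4*x+2)*(4*(x+1))) / 9) * ((3*x+1)*(3*x+2)*(3*(x+1)))))"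
    unfolding chebyshev_ratio_def e12 e6 e4 e3 e1 f12 f6 f4 p3 x_def[symmetric]
    by (simp only: times_divide_times_eq mult_ac)
  also have "(Y * V * U * (x + 1)) / ((U / 64) * (V * ((4*x+2)*(4*(x+1))) / 9) * ((3*x+1)*(3*x+2)*(3*(x+1))))
      = 48 * Y / ((4*x+2) * (3*x+1) * (3*x+2) * (x+1))"
    using UV x by (simp add: divide_simps) (simp add: algebra_simps)
  finally have eq: "chebyshev_ratio (Suc t) = chebyshev_ratio t * (48 * Y / ((4*x+2) * (3*x+1) * (3*x+2) * (x+1)))" .
  have "(4*x+2) * (3*x+1) * (3*x+2) * (x+1) \<noteq> 0" using x by simp
  then have "chebyshev_ratio (Suc t) * ((4*x+2) * (3*x+1) * (3*x+2) * (x+1)) = chebyshev_ratio t * (48 * Y)"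
    unfolding eq mult.assoc[of "chebyshev_ratio t"] nonzero_eq_divide_eq[symmetric] by (metis nonzero_eq_divide_eq)
  then show ?thesis by (simp only: x_def Y_def mult.assoc)
qed

text \<open>Successive quotients tend to \<open>12 ^ 12 / (6 ^ 6 * 4 ^ 4 * 3 ^ 3) = 27648\<close>.
  They reach \<open>22200\<close> first at \<open>t = 2\<close>, and \<open>22200\<close> is just
  above \<open>exp 10\<close>.\<close>

lemma chebyshev_ratio_ge:
  "chebyshev_ratio (s + 2) \<ge> chebyshev_ratio 2 * 22200 ^ s"
proof (induction s)
  case 0 show ?case by (simp add: numeral_2_eq_2)
next
  case (Suc s)
  define x where "x = real s"
  have x: "x \<ge> 0" by (simp add: x_def)
  define q where "q = (4 * x + 10) * (3 * x + 7) * (3 * x + 8) * (x + 3)"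
  have q: "q > 0" using x by (simp add: q_def)
  have "22200 * q \<le> 48 * (12 * x + 25) * (12 * x + 29) * (12 * x + 31) * (12 * x + 35)"
  proof -
    have "0 \<le> x * x" "0 \<le> x * x * x" "0 \<le> x * x * x * x" using x by auto
    then show ?thesis using x unfolding q_def by (simp add: algebra_simps)
  qed
  then have "chebyshev_ratio (s + 2) * (22200 * q)
      \<le> chebyshev_ratio (s + 2) * (48 * (12 * x + 25) * (12 * x + 29) * (12 * x + 31) * (12 * x + 35))"
    using chebyshev_ratio_pos[of "s + 2"] by (intro mult_left_mono) auto
  also have "\<dots> = chebyshev_ratio (Suc (s + 2)) * q"
    using chebyshev_ratio_Suc[of "s + 2"] by (simp add: q_def x_def algebra_simps)
  finally have "chebyshev_ratio (s + 2) * 22200 \<le> chebyshev_ratio (Suc s + 2)" using q by simp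
  then show ?case using Suc by simp
qed

text \<open>As a common multiple of \<open>1\<close> to \<open>D - 1\<close>, \<open>m\<close> is at
  least the ratio at \<open>t\<close>, about \<open>D / 12\<close>, so \<open>10 * D / 12\<close> is
  at most \<open>2 * ln n\<close> up to a constant. For the later comparison of \<open>n / D\<close>
  with \<open>sqrt (2 * m)\<close> it matters that \<open>12 / 5 < sqrt 6\<close>.\<close>

lemma snd_nd_log_bound:
  "\<exists>B. \<forall>n m. 0 < n \<longrightarrow> 0 < m \<longrightarrow> m \<le> n\<^sup>2 \<longrightarrow> real (snd_nd m) \<le> 12 / 5 * ln (real n) + B"
proof (intro exI allI impI)
  define c where "c = chebyshev_ratio 2"
  have c: "c > 0" unfolding c_def by (rule chebyshev_ratio_pos)
  fix n m :: nat assume n: "0 < n" and m: "0 < m" "m \<le> n\<^sup>2"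
  define D where "D = snd_nd m"
  define t where "t = (D - 1) div 12"
  note Dp = snd_nd_props[OF m(1), folded D_def]
  have Dt: "D \<le> 12 * t + 12" unfolding t_def by linarith
  have lnn: "ln (real n) \<ge> 0" using n by simp
  show "real (snd_nd m) \<le> 12 / 5 * ln (real n) + (36 + 12 / 10 * \<bar>ln c\<bar>)"
  proof (cases "t < 2")
    case True
    then have "real D \<le> 36" using Dt by linarith
    moreover have "0 \<le> 12 / 5 * ln (real n)" "0 \<le> 12 / 10 * \<bar>ln c\<bar>" using lnn by auto
    ultimately show ?thesis unfolding D_def[symmetric] by linarith
  next
    case False
    define s where "s = t - 2"
    have ts: "t = s + 2" using False by (simp add: s_def)
    have "k dvd m" if "0 < k" "k \<le> 12 * t" for k
    proof (rule Dp(3)[OF that(1)])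
      have "12 * t \<le> D - 1" unfolding t_def by simp
      then show "k < D" using that Dp(2) by linarith
    qed
    then have "fact (12 * t) * fact t dvd fact (6 * t) * fact (4 * t) * fact (3 * t) * m"
      by (rule chebyshev_ratio_dvd[OF m(1)])
    then have "fact (12 * t) * fact t \<le> fact (6 * t) * fact (4 * t) * fact (3 * t) * m"
      using m(1) by (intro dvd_imp_le) auto
    then have "real (fact (12 * t) * fact t) \<le> real (fact (6 * t) * fact (4 * t) * fact (3 * t) * m)"
      by (rule of_nat_mono)
    then have "chebyshev_ratio t \<le> real m" unfolding chebyshev_ratio_def by (simp add: field_simps)
    then have "c * 22200 ^ s \<le> real m" using chebyshev_ratio_ge[of s] unfolding c_def ts by linarith
    also have "\<dots> \<le> (real n)\<^sup>2" using m(2) by (metis of_nat_le_iff of_nat_power)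
    finally have "ln (c * 22200 ^ s) \<le> ln ((real n)\<^sup>2)" using c n by (subst ln_le_cancel_iff) auto
    then have 1: "ln c + real s * ln 22200 \<le> 2 * ln (real n)"
      using c n by (simp add: ln_mult ln_realpow)
    have "10 \<le> ln (22200::real)"
    proof -
      have "exp (10::real) = exp 1 ^ 10" using exp_of_nat_mult[of 10 "1::real"] by simp
      also have "\<dots> \<le> (272 / 100) ^ 10" using e_less_272 by (intro power_mono) auto
      also have "\<dots> \<le> 22200" by (simp add: power_divide)
      finally have "ln (exp 10) \<le> ln (22200::real)" by (subst ln_le_cancel_iff) auto
      then show ?thesis by simp
    qed
    then have "real s * 10 \<le> real s * ln 22200" by (intro mult_left_mono) auto
    then have "real s * 10 \<le> 2 * ln (real n) + \<bar>ln c\<bar>" using 1 by linarith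
    moreover have "real D \<le> 12 * real s + 36" using Dt ts by linarith
    ultimately show ?thesis unfolding D_def[symmetric] by linarith
  qed
qed

section \<open>Asymptotics\<close>

text \<open>In this range \<open>sqrt (2 * m) <= n / (sqrt 6 * ln n)\<close>, whereas a set larger
  than \<open>s_fun n m\<close> has more than \<open>n / D\<close> elements, with
  \<open>D <= 2.42 * ln n\<close>. As \<open>2.42 * 1.01 < sqrt 6\<close>, it beats
  \<open>sqrt (2 * m)\<close> by one percent and hits \<open>m\<close>.\<close>

lemma g_fun_eq_s_fun_eventually:
  "\<forall>\<^sub>F n in sequentially. \<forall>m>0. 10000 * real n * ln (real n) \<le> real m \<longrightarrow>
    real m \<le> (real n)\<^sup>2 / (12 * (ln (real n))\<^sup>2) \<longrightarrow> int (g_fun n m) = s_fun n m"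
proof -
  obtain B where B: "\<And>n m. 0 < n \<Longrightarrow> 0 < m \<Longrightarrow> m \<le> n\<^sup>2 \<Longrightarrow> real (snd_nd m) \<le> 12 / 5 * ln (real n) + B"
    using snd_nd_log_bound by blast
  have hit: "\<forall>\<^sub>F n in sequentially. \<forall>m A. A \<subseteq> {1..n} \<longrightarrow> 0 < m \<longrightarrow> 10000 * real n * ln (real n) \<le> real m \<longrightarrow>
    real n / (3 * ln (real n)) \<le> real (card A) \<longrightarrow> n div snd_nd m + snd_nd m \<le> card A + 1 \<longrightarrow>
    (1 + 1 / 100) * sqrt (2 * real m) \<le> real (card A) \<longrightarrow> m \<in> subset_sums A"
    by (rule subset_sums_hits_eventually) simp
  have e1: "\<forall>\<^sub>F n in sequentially. 12 / 5 * ln (real n) + B \<le> 121 / 50 * ln (real n)"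
    by real_asymp
  have e2: "\<forall>\<^sub>F n in sequentially. 1 \<le> ln (real n)"
    by real_asymp
  show ?thesis
    using hit e1 e2
  proof eventually_elim
    case (elim n)
    define l where "l = ln (real n)"
    have l: "1 \<le> l" using elim(3) by (simp add: l_def)
    have n0: "n > 0" using l by (cases n) (auto simp: l_def)
    show ?case
    proof (intro allI impI)
      fix m :: nat
      assume m: "m > 0" "10000 * real n * ln (real n) \<le> real m" "real m \<le> (real n)\<^sup>2 / (12 * (ln (real n))\<^sup>2)"
      define D where "D = snd_nd m"
      have l2: "1 \<le> l\<^sup>2" using l by simp
      have m12: "12 * l\<^sup>2 * real m \<le> (real n)\<^sup>2" using m(3) l unfolding l_def[symmetric] by (simp add: field_simps)
      have "12 * real m \<le> 12 * l\<^sup>2 * real m" using l2 by (intro mult_right_mono) auto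
      then have m12': "12 * real m \<le> (real n)\<^sup>2" using m12 by linarith
      then have "real (12 * m) \<le> real (n\<^sup>2)" by simp
      then have mn: "12 * m \<le> n\<^sup>2" by (simp only: of_nat_le_iff)
      have "2 * m \<le> n * (n + 1)" using mn by (simp add: power2_eq_square)
      then have ge: "s_fun n m \<le> int (g_fun n m)" by (rule s_fun_le_g_fun[OF m(1)])
      have D2: "2 \<le> D" using snd_nd_props(2)[OF m(1)] by (simp add: D_def)
      have "real D \<le> 12 / 5 * l + B" using B[OF n0 m(1)] mn unfolding D_def l_def by simp
      then have Dl: "real D \<le> 121 / 50 * l" using elim(2) unfolding l_def by linarith
      have "int (g_fun n m) \<le> s_fun n m"
      proof (rule ccontr)
        assume "\<not> ?thesis"
        moreover obtain A where A: "A \<subseteq> {1..n}" "m \<notin> subset_sums A" "card A = g_fun n m"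
          using g_fun_attained[OF m(1)] by blast
        ultimately have cA: "n div D + D \<le> card A + 1" unfolding s_fun_def D_def by linarith
        have "real n < real D * (real (n div D) + 1)"
        proof -
          have "n < D + n div D * D" using dividend_less_div_times[of D n] D2 by simp
          then have "real n < real (D + n div D * D)" by (simp only: of_nat_less_iff)
          then show ?thesis by (simp add: algebra_simps)
        qed
        also have "\<dots> \<le> real D * real (card A)" using cA D2 by (intro mult_left_mono) auto
        also have "\<dots> \<le> 121 / 50 * l * real (card A)" using Dl by (intro mult_right_mono) auto
        finally have nA: "real n \<le> 121 / 50 * l * real (card A)" by simp
        have "(1 + 1 / 100) * sqrt (2 * real m) \<le> real (card A)"
        proof -
          have "(real n)\<^sup>2 \<le> (121 / 50 * l * real (card A))\<^sup>2" using nA by (intro power_mono) auto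
          then have "12 * l\<^sup>2 * real m \<le> (121 / 50)\<^sup>2 * l\<^sup>2 * (real (card A))\<^sup>2"
            using m12 unfolding power_mult_distrib by linarith
          then have "l\<^sup>2 * (12 * real m) \<le> l\<^sup>2 * ((121 / 50)\<^sup>2 * (real (card A))\<^sup>2)" by (simp only: mult_ac)
          then have "12 * real m \<le> (121 / 50)\<^sup>2 * (real (card A))\<^sup>2" using l2 by (simp only: mult_le_cancel_left_pos)
          then have "(1 + 1 / 100)\<^sup>2 * (2 * real m) \<le> (real (card A))\<^sup>2" by (simp add: power2_eq_square)
          then have "((1 + 1 / 100) * sqrt (2 * real m))\<^sup>2 \<le> (real (card A))\<^sup>2"
            by (subst power_mult_distrib, subst real_sqrt_pow2) auto
          then show ?thesis by (rule power2_le_imp_le) simp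
        qed
        moreover have "real n / (3 * l) \<le> real (card A)"
        proof -
          have "121 / 50 * l * real (card A) \<le> 3 * l * real (card A)" using l by (intro mult_right_mono) auto
          then show ?thesis using nA l by (simp add: divide_le_eq mult_ac)
        qed
        ultimately have "m \<in> subset_sums A" using elim(1) A(1) m(1,2) cA unfolding D_def l_def by blast
        then show False using A(2) by blast
      qed
      then show "int (g_fun n m) = s_fun n m" using ge by simp
    qed
  qed
qed

lemma g_fun_ge_sqrt:
  assumes "m > 0" "2 * m \<le> n * (n + 1)"
  shows "sqrt (2 * real m) - 2 \<le> real (g_fun n m)"
proof -
  define x where "x = sqrt (2 * real m)"
  have x0: "0 \<le> x" by (simp add: x_def)
  have xx: "x * x = 2 * real m" by (simp add: x_def)
  show ?thesis
  proof (cases "x < 2")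
    case True
    have "0 \<le> real (g_fun n m)" by simp
    then show ?thesis using True unfolding x_def[symmetric] by linarith
  next
    case False
    \<comment> \<open>One less than the floor, so that
      \<open>k * (k + 1) <= (x - 1) * x < 2 * m\<close>.\<close>
    define k where "k = nat \<lfloor>x\<rfloor> - 1"
    have k: "real k \<le> x - 1" "x - 2 \<le> real k" using False unfolding k_def by linarith+
    have "k \<le> n"
    proof (rule ccontr)
      assume "\<not> k \<le> n"
      then have "real n + 1 \<le> real k" by linarith
      then have "real n + 2 \<le> x" using k(1) by linarith
      then have "(real n + 2) * (real n + 2) \<le> x * x" by (intro mult_mono) auto
      moreover have "2 * real m \<le> real n * (real n + 1)"
        using assms(2) by (metis of_nat_le_iff of_nat_mult of_nat_add of_nat_1 of_nat_numeral)
      ultimately show False using xx by (simp add: algebra_simps)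
    qed
    moreover have "k * (k + 1) < 2 * m"
    proof -
      have "real k * (real k + 1) \<le> (x - 1) * x" using k by (intro mult_mono) auto
      also have "\<dots> < x * x" using False by (simp add: algebra_simps)
      finally have "real (k * (k + 1)) < real (2 * m)" using xx by (simp add: algebra_simps)
      then show ?thesis by (simp only: of_nat_less_iff)
    qed
    ultimately have "k \<le> g_fun n m" by (rule g_fun_ge_initial)
    then show ?thesis using k(2) unfolding x_def[symmetric] by linarith
  qed
qed

text \<open>The loss of \<open>2\<close> in \<open>g_fun_ge_sqrt\<close> is eventually below \<eta>
  times the square root. If both upper alternatives failed, an extremal set would hit
  \<open>m\<close>: the lower bound on \<open>m\<close> gives
  \<open>sqrt (2 * m) >= n / (3 * ln n)\<close> and hence the density needed.\<close>

lemma g_fun_sqrt_bounds_eventually: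
  fixes \<eta> :: real
  assumes \<eta>: "\<eta> > 0"
  shows "\<forall>\<^sub>F n in sequentially. \<forall>m>0. (real n)\<^sup>2 / (12 * (ln (real n))\<^sup>2) \<le> real m \<longrightarrow>
    2 * m \<le> n * (n + 1) \<longrightarrow> (1 - \<eta>) * sqrt (2 * real m) \<le> real (g_fun n m) \<and>
      (int (g_fun n m) \<le> s_fun n m \<or> real (g_fun n m) \<le> (1 + \<eta>) * sqrt (2 * real m))"
proof -
  have e1: "\<forall>\<^sub>F n in sequentially. 2 / \<eta> \<le> real n / (3 * ln (real n))"
    by real_asymp
  have e2: "\<forall>\<^sub>F n in sequentially. 1 \<le> ln (real n)"
    by real_asymp
  have e3: "\<forall>\<^sub>F n in sequentially. 10000 * real n * ln (real n) \<le> (real n)\<^sup>2 / (12 * (ln (real n))\<^sup>2)"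
    by real_asymp
  show ?thesis
    using subset_sums_hits_eventually[OF \<eta>] e1 e2 e3
  proof eventually_elim
    case (elim n)
    define l where "l = ln (real n)"
    have l: "1 \<le> l" using elim(3) by (simp add: l_def)
    show ?case
    proof (intro allI impI)
      fix m :: nat
      assume m: "m > 0" "(real n)\<^sup>2 / (12 * (ln (real n))\<^sup>2) \<le> real m" "2 * m \<le> n * (n + 1)"
      define x where "x = sqrt (2 * real m)"
      have nx: "real n / (3 * l) \<le> x"
      proof -
        have "(real n / (3 * l))\<^sup>2 = (real n)\<^sup>2 / (9 * l\<^sup>2)" by (simp add: power_divide power_mult_distrib)
        also have "\<dots> \<le> (real n)\<^sup>2 / (6 * l\<^sup>2)" using l by (intro divide_left_mono) auto
        also have "\<dots> = 2 * ((real n)\<^sup>2 / (12 * l\<^sup>2))" by simp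
        also have "\<dots> \<le> 2 * real m" using m(2) by (simp add: l_def)
        finally show ?thesis unfolding x_def by (rule real_le_rsqrt)
      qed
      have x2: "2 / \<eta> \<le> x" using nx elim(2) unfolding l_def by linarith
      have "2 \<le> \<eta> * x" using x2 \<eta> by (simp add: divide_le_eq mult.commute)
      then have 1: "(1 - \<eta>) * x \<le> real (g_fun n m)"
        using g_fun_ge_sqrt[OF m(1,3)] unfolding x_def[symmetric] by (simp add: algebra_simps)
      have 2: "int (g_fun n m) \<le> s_fun n m \<or> real (g_fun n m) \<le> (1 + \<eta>) * x"
      proof (rule ccontr)
        assume no: "\<not> ?thesis"
        obtain A where A: "A \<subseteq> {1..n}" "m \<notin> subset_sums A" "card A = g_fun n m"
          using g_fun_attained[OF m(1)] by blast
        have "n div snd_nd m + snd_nd m \<le> card A + 1" using no A(3) unfolding s_fun_def by linarith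
        moreover have hx: "(1 + \<eta>) * x \<le> real (card A)" using no A(3) by simp
        moreover have "x \<le> (1 + \<eta>) * x"
        proof -
          have "0 \<le> \<eta> * x" using \<open>2 \<le> \<eta> * x\<close> by linarith
          then show ?thesis by (simp add: algebra_simps)
        qed
        then have "real n / (3 * l) \<le> real (card A)" using nx hx by linarith
        moreover have "10000 * real n * ln (real n) \<le> real m" using elim(4) m(2) by linarith
        ultimately have "m \<in> subset_sums A" using elim(1) A(1) m(1) unfolding x_def l_def by blast
        then show False using A(2) by blast
      qed
      show "(1 - \<eta>) * sqrt (2 * real m) \<le> real (g_fun n m) \<and>
          (int (g_fun n m) \<le> s_fun n m \<or> real (g_fun n m) \<le> (1 + \<eta>) * sqrt (2 * real m))"
        using 1 2 unfolding x_def by blast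
    qed
  qed
qed

lemma g_fun_max_asymptotics:
  "\<exists>\<epsilon>::nat \<Rightarrow> real. \<epsilon> \<longlonglongrightarrow> 0 \<and>
        (\<forall>n m::nat. 0 < n \<longrightarrow> 0 < m \<longrightarrow>
          (real n)^2 / (12 * (ln (real n))^2) \<le> real m \<longrightarrow>
          m \<le> (n + 1) choose 2 \<longrightarrow>
          (\<exists>\<delta>::real. \<bar>\<delta>\<bar> \<le> \<epsilon> n \<and>
             real (g_fun n m) = max (of_int (s_fun n m)) ((1 + \<delta>) * sqrt (2 * real m))))"
proof -
  define valid where "valid n = {m. 0 < m \<and> (real n)^2 / (12 * (ln (real n))^2) \<le> real m \<and> m \<le> (n + 1) choose 2}" for n :: nat
  define rel where "rel n m = real (g_fun n m) / sqrt (2 * real m) - 1" for n m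
  \<comment> \<open>When \<open>g_fun\<close> exceeds \<open>s_fun\<close>, the square root term
    must attain the maximum. Otherwise the two agree, and \<open>min 0\<close> keeps that term from
    exceeding them.\<close>
  define dev where "dev n m = (if s_fun n m < int (g_fun n m) then rel n m else min 0 (rel n m))" for n m
  \<comment> \<open>One bound has to serve all of the finitely many admissible \<open>m\<close>;
    inserting \<open>0\<close> keeps \<open>Max\<close> meaningful when there are none.\<close>
  define eps where "eps n = Max (insert 0 ((\<lambda>m. \<bar>dev n m\<bar>) ` valid n))" for n
  have fin: "finite (valid n)" for n
    by (rule finite_subset[of _ "{..(n + 1) choose 2}"]) (auto simp: valid_def)
  have mn: "2 * m \<le> n * (n + 1)" if m: "m \<in> valid n" for n m
  proof -
    have "2 * m \<le> 2 * ((n + 1) choose 2)" using m by (simp add: valid_def)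
    also have "\<dots> = 2 * ((n + 1) * n div 2)" by (simp add: choose_two)
    also have "\<dots> \<le> (n + 1) * n" by (rule times_div_less_eq_dividend)
    finally show ?thesis by (simp only: mult.commute)
  qed
  have eq: "real (g_fun n m) = max (of_int (s_fun n m)) ((1 + dev n m) * sqrt (2 * real m))"
    if m: "m \<in> valid n" for n m
  proof -
    have x: "sqrt (2 * real m) > 0" using m by (simp add: valid_def)
    have r: "(1 + rel n m) * sqrt (2 * real m) = real (g_fun n m)" using x by (simp add: rel_def)
    show ?thesis
    proof (cases "s_fun n m < int (g_fun n m)")
      case True
      then have "of_int (s_fun n m) \<le> real (g_fun n m)" by linarith
      then show ?thesis using True r by (simp add: dev_def)
    next
      case False
      then have s: "s_fun n m = int (g_fun n m)"
        using s_fun_le_g_fun[OF _ mn[OF m]] m by (simp add: valid_def)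
      have "(1 + dev n m) * sqrt (2 * real m) \<le> (1 + rel n m) * sqrt (2 * real m)"
        using x False by (intro mult_right_mono) (auto simp: dev_def)
      then show ?thesis using r s by simp
    qed
  qed
  have le: "\<bar>dev n m\<bar> \<le> eps n" if "m \<in> valid n" for n m
    unfolding eps_def using fin that by (intro Max_ge) auto
  have "eps \<longlonglongrightarrow> 0"
  proof (rule tendstoI)
    fix e :: real assume e: "e > 0"
    have "\<forall>\<^sub>F n in sequentially. \<forall>m>0. (real n)\<^sup>2 / (12 * (ln (real n))\<^sup>2) \<le> real m \<longrightarrow>
      2 * m \<le> n * (n + 1) \<longrightarrow> (1 - e / 2) * sqrt (2 * real m) \<le> real (g_fun n m) \<and>
      (int (g_fun n m) \<le> s_fun n m \<or> real (g_fun n m) \<le> (1 + e / 2) * sqrt (2 * real m))"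
      by (rule g_fun_sqrt_bounds_eventually) (use e in simp)
    then show "\<forall>\<^sub>F n in sequentially. dist (eps n) 0 < e"
    proof eventually_elim
      case (elim n)
      have "\<bar>dev n m\<bar> \<le> e / 2" if m: "m \<in> valid n" for m
      proof -
        have x: "sqrt (2 * real m) > 0" using m by (simp add: valid_def)
        have b: "(1 - e / 2) * sqrt (2 * real m) \<le> real (g_fun n m)"
          "int (g_fun n m) \<le> s_fun n m \<or> real (g_fun n m) \<le> (1 + e / 2) * sqrt (2 * real m)"
          using elim mn[OF m] m unfolding valid_def by blast+
        have lo: "- (e / 2) \<le> rel n m" using b(1) x by (simp add: rel_def field_simps)
        show ?thesis
        proof (cases "s_fun n m < int (g_fun n m)")
          case True
          then have "rel n m \<le> e / 2" using b(2) x by (simp add: rel_def field_simps)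
          then show ?thesis using lo True by (simp add: dev_def)
        next
          case False
          then show ?thesis using lo e by (auto simp: dev_def)
        qed
      qed
      then have "eps n \<le> e / 2" unfolding eps_def using fin e by (subst Max_le_iff) auto
      moreover have "0 \<le> eps n" unfolding eps_def using fin by (intro Max_ge) auto
      ultimately show ?case using e by simp
    qed
  qed
  moreover have "\<exists>\<delta>. \<bar>\<delta>\<bar> \<le> eps n \<and> real (g_fun n m) = max (of_int (s_fun n m)) ((1 + \<delta>) * sqrt (2 * real m))"
    if "0 < m" "(real n)^2 / (12 * (ln (real n))^2) \<le> real m" "m \<le> (n + 1) choose 2" for n m
    using le[of m n] eq[of m n] that unfolding valid_def by blast
  ultimately show ?thesis by blast
qed

theorem theorem1p7:
  shows "\<exists>C::real.
    (\<forall>n m::nat. 0 < n \<longrightarrow> 0 < m \<longrightarrow>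
        C * real n * ln (real n) \<le> real m \<longrightarrow>
        real m \<le> (real n)^2 / (12 * (ln (real n))^2) \<longrightarrow>
        int (g_fun n m) = s_fun n m)
    \<and> (\<exists>\<epsilon>::nat \<Rightarrow> real. \<epsilon> \<longlonglongrightarrow> 0 \<and>
        (\<forall>n m::nat. 0 < n \<longrightarrow> 0 < m \<longrightarrow>
          (real n)^2 / (12 * (ln (real n))^2) \<le> real m \<longrightarrow>
          m \<le> (n + 1) choose 2 \<longrightarrow>
          (\<exists>\<delta>::real. \<bar>\<delta>\<bar> \<le> \<epsilon> n \<and>
             real (g_fun n m) = max (of_int (s_fun n m)) ((1 + \<delta>) * sqrt (2 * real m)))))"
proof -
  obtain n0 where n0: "\<And>n m. n \<ge> n0 \<Longrightarrow> m > 0 \<Longrightarrow> 10000 * real n * ln (real n) \<le> real m \<Longrightarrow>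
      real m \<le> (real n)\<^sup>2 / (12 * (ln (real n))\<^sup>2) \<Longrightarrow> int (g_fun n m) = s_fun n m"
    using g_fun_eq_s_fun_eventually unfolding eventually_sequentially by blast
  \<comment> \<open>The second summand makes the interval for \<open>m\<close> empty when \<open>2 \<le> n < n0\<close>; it is empty for
    \<open>n = 1\<close> because then the upper bound is \<open>1 / 0 = 0\<close>.\<close>
  define C where "C = 10000 + real n0 / (12 * (ln 2) ^ 3)"
  have "int (g_fun n m) = s_fun n m"
    if nm: "0 < n" "0 < m" "C * real n * ln (real n) \<le> real m" "real m \<le> (real n)^2 / (12 * (ln (real n))^2)" for n m
  proof -
    have "n \<noteq> 1" using nm(2,4) by auto
    then have n2: "2 \<le> n" using nm(1) by linarith
    define l where "l = ln (real n)"
    have l2: "ln 2 \<le> l" using n2 by (simp add: l_def)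
    have ln2: "ln 2 > (0::real)" by simp
    have l0: "l > 0" using l2 ln2 by linarith
    have "C * real n * l * (12 * l\<^sup>2) \<le> (real n)\<^sup>2"
    proof -
      have "C * real n * l \<le> (real n)\<^sup>2 / (12 * l\<^sup>2)" using nm(3,4) unfolding l_def by linarith
      then show ?thesis using l0 by (simp add: pos_le_divide_eq)
    qed
    then have "real n * (C * (12 * l ^ 3)) \<le> real n * real n" by (simp add: power2_eq_square power3_eq_cube mult_ac)
    then have Cn: "C * (12 * l ^ 3) \<le> real n" using nm(1) by simp
    have "real n0 = real n0 / (12 * (ln 2) ^ 3) * (12 * (ln 2) ^ 3)" using ln2 by simp
    also have "\<dots> \<le> C * (12 * l ^ 3)"
      using l2 ln2 by (intro mult_mono power_mono) (auto simp: C_def)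
    finally have "n0 \<le> n" using Cn by linarith
    moreover have "10000 * real n * ln (real n) \<le> real m"
    proof -
      have "10000 * real n * l \<le> C * real n * l" using l0 ln2 by (intro mult_right_mono) (auto simp: C_def)
      then show ?thesis using nm(3) by (simp add: l_def)
    qed
    ultimately show ?thesis using n0 nm(2,4) by blast
  qed
  then show ?thesis using g_fun_max_asymptotics by (intro exI[of _ C]) blast
qed

end
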